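(* Let $G$ be a generalized H-type Carnot group of rank $k$ and dimension $n$. The Jacobian determinant $J(u,v)$ of the exponential map $\exp_e(u,v)=(x,z)$ is $$J(u,v)=\frac{2^{2d}}{\alpha^2|v|^{2d+2}}\left(\sum_{i=1}^d|u_i|^2\,\frac{\alpha_i|v|-\sin(\alpha_i|v|)}{2|v|^3\alpha_i}\right)^{n-k-1}\times$$ $$\times\sum_{i=1}^d|u_i|^2\ \prod_{j\ne i}\sin\left(\frac{\alpha_j|v|}{2}\right)^2\ \sin\left(\frac{\alpha_i|v|}{2}\right)\left(\sin\left(\frac{\alpha_i|v|}{2}\right)-\frac{\alpha_i|v|}{2}\cos\left(\frac{\alpha_i|v|}{2}\right)\right),$$ where $\alpha=\prod_{j=1}^d\alpha_j$ is the product of the non-zero singular values of $L_v/|v|$ (one for each pair). If $v=0$, the formula must be taken in the limit $v\to0$. In particular, $$J(u,0)=\left(\sum_{i=1}^d\frac{(\alpha_i|u_i|)^2}{12}\right)^{n-k}=\left(\frac{|Su|^2}{12}\right)^{n-k}.$$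
   Context: **Generalized H-type Carnot groups.** A step 2 Carnot group of rank $k$ and dimension $n$ is a connected, simply connected Lie group $G$ of dimension $n$ whose Lie algebra splits as $\mathfrak g=\mathfrak g_1\oplus\mathfrak g_2$ with $\dim\mathfrak g_1=k$, $\dim\mathfrak g_2=n-k\ge 1$, $[\mathfrak g_1,\mathfrak g_1]=\mathfrak g_2$, $[\mathfrak g_1,\mathfrak g_2]=[\mathfrak g_2,\mathfrak g_2]=0$, with a fixed scalar product $g$ on $\mathfrak g$ such that $\mathfrak g_1\perp\mathfrak g_2$. For $V\in\mathfrak g_2$, $J_V:\mathfrak g_1\to\mathfrak g_1$ is the skew-symmetric operator with $g(X,J_VY)=g(V,[X,Y])$ for all $X,Y\in\mathfrak g_1$. The group is of generalized H-type if there is a symmetric, non-zero, non-negative operator $S:\mathfrak g_1\to\mathfrak g_1$ with $J_VJ_W+J_WJ_V=-2g(V,W)S^2$ for all $V,W\in\mathfrak g_2$. The sub-Riemannian structure is the left-invariant distribution generated by $\mathfrak g_1$ with the left-invariant metric induced by $g|_{\mathfrak g_1}$. **Coordinates.** Fix orthonormal bases $e_1,\dots,e_k$ of $\mathfrak g_1$ (chosen so that $S$ is diagonal) and $f_1,\dots,f_{n-k}$ of $\mathfrak g_2$. A point $p\in G$ has coordinates $(x,z)\in\mathbb R^k\times\mathbb R^{n-k}$ iff $p=\mathrm{exp}_G(\sum_i x_ie_i+\sum_\alpha z_\alpha f_\alpha)$, with $\mathrm{exp}_G$ the group exponential; the identity is $e=(0,0)$. With $[e_i,e_j]=\sum_\alpha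 L^\alpha_{ij}f_\alpha$, put $L_v:=\sum_\alpha v_\alpha L^\alpha$ for $v\in\mathbb R^{n-k}$, so that $L_v$ is skew-symmetric and $L_v^2=-|v|^2S^2$. A global orthonormal frame of the distribution is $X_i=\partial_{x_i}-\frac12\sum_{\alpha,j}L^\alpha_{ij}x_j\partial_{z_\alpha}$, $i=1,\dots,k$. A covector $\lambda\in T_e^*G$ is written $\lambda=\sum_iu_i\,dx_i+\sum_\alpha v_\alpha\,dz_\alpha=(u,v)\in\mathbb R^k\times\mathbb R^{n-k}$. **Exponential map.** The Hamiltonian is $H(\lambda)=\frac12\sum_i\langle\lambda,X_i\rangle^2$ on $T^*G$, with Hamiltonian vector field $\vec H$; $\exp_e(\lambda)=\pi(\lambda(1))$, where $\pi:T^*G\to G$ is the projection and $\lambda(t)$ is the integral curve of $\vec H$ with $\lambda(0)=\lambda$. $J(u,v)$ is the determinant of the Jacobian matrix of $(u,v)\mapsto(x,z)=\exp_e(u,v)$ in these coordinates. **Notation for the eigenvalues and the decomposition of $u$.** The non-zero eigenvalues of $S$ appear in pairs; they are denoted $0<\alpha_1\le\dots\le\alpha_d$, each $\alpha_i$ being listed once for each pair, so that the rank of $S$ is $2d$ with $d\ge1$. For $v\ne0$ there is an orthogonal change of basis of $\mathbb R^k$ putting $L_v$ in its real normal form, which is block diagonal with blocks $\mathbf 0_{k-2d}$, $|v|\alpha_1\mathbf J,\dots,|v|\alpha_d\mathbf J$, where $\mathbf J=\begin{pmatrix}0&1\\-1&0\end{pmatrix}$. Correspondingly one writes $u=(u_0,u_1,\dots,u_d)$,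 with $u_0\in\mathbb R^{k-2d}$ the component in $\ker L_v$ and $u_i\in\mathbb R^2$ the component in the real plane associated with the singular value $\alpha_i|v|$ (this decomposition is not unique). For $v=0$ the decomposition is the one relative to the block form $S=\mathrm{diag}(\mathbf 0_{k-2d},\alpha_1\mathbf 1_2,\dots,\alpha_d\mathbf 1_2)$. $|\cdot|$ is the Euclidean norm. *)

theory Defs
  imports "HOL-Analysis.Analysis"
begin

section \<open>Generalized H-type Carnot algebras\<close>

text \<open>
  The Lie algebra is the whole type \<^typ>\<open>'g\<close>, and its fixed scalar product is the inner product
  of that type. The first clauses after bilinearity say that it is a Lie algebra.
\<close>

definition step2_carnot_algebra ::
    "('g::euclidean_space \<Rightarrow> 'g \<Rightarrow> 'g) \<Rightarrow> 'g set \<Rightarrow> 'g set \<Rightarrow> bool" where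
  "step2_carnot_algebra br g1 g2 \<longleftrightarrow>
     bilinear br \<and>
     (\<forall>X. br X X = 0) \<and>
     (\<forall>X Y Z. br X (br Y Z) + br Y (br Z X) + br Z (br X Y) = 0) \<and>
     subspace g1 \<and> subspace g2 \<and>
     {X + V |X V. X \<in> g1 \<and> V \<in> g2} = UNIV \<and> g1 \<inter> g2 = {0} \<and>
     (\<forall>X\<in>g1. \<forall>V\<in>g2. X \<bullet> V = 0) \<and>
     dim g2 \<ge> 1 \<and>
     span {br X Y |X Y. X \<in> g1 \<and> Y \<in> g1} = g2 \<and>
     (\<forall>X\<in>g1. \<forall>V\<in>g2. br X V = 0) \<and>
     (\<forall>V\<in>g2. \<forall>W\<in>g2. br V W = 0)"

definition J_op :: "('g::euclidean_space \<Rightarrow> 'g \<Rightarrow> 'g) \<Rightarrow> 'g set \<Rightarrow> 'g \<Rightarrow> 'g \<Rightarrow> 'g" where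
  "J_op br g1 V Y = (THE Z. Z \<in> g1 \<and> (\<forall>X\<in>g1. X \<bullet> Z = V \<bullet> br X Y))"

definition operator_on :: "'g::euclidean_space set \<Rightarrow> ('g \<Rightarrow> 'g) \<Rightarrow> bool" where
  "operator_on W S \<longleftrightarrow>
     (\<forall>X\<in>W. S X \<in> W) \<and>
     (\<forall>X\<in>W. \<forall>Y\<in>W. S (X + Y) = S X + S Y) \<and>
     (\<forall>c. \<forall>X\<in>W. S (c *\<^sub>R X) = c *\<^sub>R S X)"

definition generalized_H_type ::
    "('g::euclidean_space \<Rightarrow> 'g \<Rightarrow> 'g) \<Rightarrow> 'g set \<Rightarrow> 'g set \<Rightarrow> ('g \<Rightarrow> 'g) \<Rightarrow> bool" where
  "generalized_H_type br g1 g2 S \<longleftrightarrow>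
     step2_carnot_algebra br g1 g2 \<and>
     operator_on g1 S \<and>
     (\<forall>X\<in>g1. \<forall>Y\<in>g1. S X \<bullet> Y = X \<bullet> S Y) \<and>
     (\<exists>X\<in>g1. S X \<noteq> 0) \<and>
     (\<forall>X\<in>g1. 0 \<le> X \<bullet> S X) \<and>
     (\<forall>V\<in>g2. \<forall>W\<in>g2. \<forall>X\<in>g1.
        J_op br g1 V (J_op br g1 W X) + J_op br g1 W (J_op br g1 V X)
          = (- 2 * (V \<bullet> W)) *\<^sub>R S (S X))"

text \<open>
  \<open>\<alpha> 1 \<le> \<dots> \<le> \<alpha> d\<close> lists the non-zero eigenvalues of \<open>S\<close>, each one half as often as its
  multiplicity.
\<close>

definition paired_eigenvalues ::
    "'g::euclidean_space set \<Rightarrow> ('g \<Rightarrow> 'g) \<Rightarrow> nat \<Rightarrow> (nat \<Rightarrow> real) \<Rightarrow> bool" where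
  "paired_eigenvalues g1 S d \<alpha> \<longleftrightarrow>
     (\<forall>i\<in>{1..d}. 0 < \<alpha> i) \<and>
     (\<forall>i\<in>{1..d}. \<forall>j\<in>{1..d}. i \<le> j \<longrightarrow> \<alpha> i \<le> \<alpha> j) \<and>
     (\<forall>t. t \<noteq> 0 \<longrightarrow> dim {X \<in> g1. S X = t *\<^sub>R X} = 2 * card {i \<in> {1..d}. \<alpha> i = t})"

definition orthonormal_basis :: "('i::finite \<Rightarrow> 'g::euclidean_space) \<Rightarrow> 'g set \<Rightarrow> bool" where
  "orthonormal_basis b W \<longleftrightarrow>
     (\<forall>i j. b i \<bullet> b j = (if i = j then 1 else 0)) \<and> span (range b) = W"


section \<open>The group in exponential coordinates\<close>

text \<open>
  The group exponential of a connected, simply connected nilpotent Lie group is a diffeomorphism.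
  Identifying the group with its Lie algebra through it, the group law is given by the
  Baker-Campbell-Hausdorff formula, which for step 2 ends after the first bracket. The point with
  coordinates \<open>q = (x, z)\<close> is \<open>point e f q\<close>.
\<close>

definition bch_mult :: "('g::euclidean_space \<Rightarrow> 'g \<Rightarrow> 'g) \<Rightarrow> 'g \<Rightarrow> 'g \<Rightarrow> 'g" where
  "bch_mult br p q = p + q + (1 / 2) *\<^sub>R br p q"

definition point ::
    "('k::finite \<Rightarrow> 'g::euclidean_space) \<Rightarrow> ('m::finite \<Rightarrow> 'g) \<Rightarrow> (real^'k) \<times> (real^'m) \<Rightarrow> 'g" where
  "point e f q = (\<Sum>i\<in>UNIV. fst q $ i *\<^sub>R e i) + (\<Sum>a\<in>UNIV. snd q $ a *\<^sub>R f a)"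

definition struct_matrix ::
    "('g::euclidean_space \<Rightarrow> 'g \<Rightarrow> 'g) \<Rightarrow> ('k::finite \<Rightarrow> 'g) \<Rightarrow> ('m::finite \<Rightarrow> 'g) \<Rightarrow> 'm \<Rightarrow> real^'k^'k" where
  "struct_matrix br e f a = (\<chi> i j. f a \<bullet> br (e i) (e j))"

definition L_matrix ::
    "('g::euclidean_space \<Rightarrow> 'g \<Rightarrow> 'g) \<Rightarrow> ('k::finite \<Rightarrow> 'g) \<Rightarrow> ('m::finite \<Rightarrow> 'g) \<Rightarrow> real^'m \<Rightarrow> real^'k^'k" where
  "L_matrix br e f v = (\<Sum>a\<in>UNIV. v $ a *\<^sub>R struct_matrix br e f a)"

definition operator_matrix :: "('k::finite \<Rightarrow> 'g::euclidean_space) \<Rightarrow> ('g \<Rightarrow> 'g) \<Rightarrow> real^'k^'k" where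
  "operator_matrix e S = (\<chi> i j. e i \<bullet> S (e j))"

definition frame ::
    "('g::euclidean_space \<Rightarrow> 'g \<Rightarrow> 'g) \<Rightarrow> ('k::finite \<Rightarrow> 'g) \<Rightarrow> ('m::finite \<Rightarrow> 'g) \<Rightarrow> 'k \<Rightarrow>
      (real^'k) \<times> (real^'m) \<Rightarrow> (real^'k) \<times> (real^'m)" where
  "frame br e f i q =
     (axis i 1, \<chi> a. - (1 / 2) * (\<Sum>j\<in>UNIV. struct_matrix br e f a $ i $ j * fst q $ j))"

lemma bilinear_simps:
  assumes "bilinear br"
  shows "br (x + y) z = br x z + br y z" "br x (y + z) = br x y + br x z"
    "br (c *\<^sub>R x) y = c *\<^sub>R br x y" "br x (c *\<^sub>R y) = c *\<^sub>R br x y"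
    "br 0 x = 0" "br x 0 = 0" "br (- x) y = - br x y" "br x (- y) = - br x y"
  using assms
  by (auto simp: bilinear_ladd bilinear_radd bilinear_lmul bilinear_rmul bilinear_lzero
      bilinear_rzero bilinear_lneg bilinear_rneg)

lemma step2_bracket_bracket:
  assumes "step2_carnot_algebra br g1 g2"
  shows "br X Y \<in> g2" "br X (br Y Z) = 0" "br (br Y Z) X = 0" "br X Y = - br Y X"
proof -
  note bl = bilinear_simps[of br]
  have b: "bilinear br" and alt: "\<And>X. br X X = 0" 
    and sp: "span {br X Y |X Y. X \<in> g1 \<and> Y \<in> g1} = g2"
    and dec: "{X + V |X V. X \<in> g1 \<and> V \<in> g2} = UNIV"
    and z1: "\<And>X V. X \<in> g1 \<Longrightarrow> V \<in> g2 \<Longrightarrow> br X V = 0"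
    and z2: "\<And>X V. X \<in> g2 \<Longrightarrow> V \<in> g2 \<Longrightarrow> br X V = 0"
    using assms unfolding step2_carnot_algebra_def by blast+
  note bl = bl[OF b]
  have skew: "br X Y = - br Y X" for X Y
  proof -
    have "br (X + Y) (X + Y) = (br X X + br Y X) + (br X Y + br Y Y)" by (simp only: bl)
    then have "br Y X + br X Y = 0" by (simp only: alt) simp
    then have "br X Y + br Y X = 0" by (simp only: add.commute)
    then show ?thesis by (simp add: eq_neg_iff_add_eq_0)
  qed
  have ex: "\<exists>A V. A \<in> g1 \<and> V \<in> g2 \<and> X = A + V" for X
  proof -
    have "X \<in> {X + V |X V. X \<in> g1 \<and> V \<in> g2}" unfolding dec by simp
    then show ?thesis by blast
  qed
  have in2: "br X Y \<in> g2" for X Y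
  proof -
    obtain A V B W where h: "A \<in> g1" "V \<in> g2" "X = A + V" "B \<in> g1" "W \<in> g2" "Y = B + W"
      using ex[of X] ex[of Y] by auto
    have "br V B = - br B V" by (rule skew)
    then have "br V B = 0" by (simp add: z1[OF h(4,2)])
    then have "br X Y = br A B" by (simp add: h(3,6) bl z1[OF h(1,5)] z2[OF h(2,5)])
    moreover have "br A B \<in> span {br X Y |X Y. X \<in> g1 \<and> Y \<in> g1}"
      using h(1,4) by (intro span_base) blast
    ultimately show ?thesis unfolding sp by simp
  qed
  have cen: "br X V = 0" if "V \<in> g2" for X V
  proof -
    obtain A W where h: "A \<in> g1" "W \<in> g2" "X = A + W" using ex by blast
    show ?thesis by (simp add: h(3) bl z1[OF h(1) that] z2[OF h(2) that])
  qed
  show "br X Y \<in> g2" by (rule in2)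
  show "br X (br Y Z) = 0" by (rule cen[OF in2])
  have "br (br Y Z) X = - br X (br Y Z)" by (rule skew)
  then show "br (br Y Z) X = 0" by (simp add: cen[OF in2])
  show "br X Y = - br Y X" by (rule skew)
qed

lemma bch_mult_group:
  assumes "step2_carnot_algebra br g1 g2"
  shows "bch_mult br (bch_mult br p q) r = bch_mult br p (bch_mult br q r)"
    "bch_mult br 0 p = p" "bch_mult br p 0 = p"
    "bch_mult br (- p) p = 0" "bch_mult br p (- p) = 0"
    "bch_mult br (s *\<^sub>R p) (t *\<^sub>R p) = (s + t) *\<^sub>R p"
proof -
  have b: "bilinear br" and alt: "\<And>X. br X X = 0" 
    using assms unfolding step2_carnot_algebra_def by blast+
  show "bch_mult br (bch_mult br p q) r = bch_mult br p (bch_mult br q r)"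
    "bch_mult br 0 p = p" "bch_mult br p 0 = p"
    "bch_mult br (- p) p = 0" "bch_mult br p (- p) = 0"
    "bch_mult br (s *\<^sub>R p) (t *\<^sub>R p) = (s + t) *\<^sub>R p"
    unfolding bch_mult_def
    by (simp_all add: bilinear_simps[OF b] alt step2_bracket_bracket(2,3)[OF assms] algebra_simps)
qed

lemma orthonormal_basis_expansion:
  assumes "orthonormal_basis b W" "x \<in> W"
  shows "x = (\<Sum>i\<in>UNIV. (b i \<bullet> x) *\<^sub>R b i)"
proof -
  have on: "\<And>i j. b i \<bullet> b j = (if i = j then 1 else 0)" and "x \<in> span (range b)"
    using assms unfolding orthonormal_basis_def by auto
  from this(2) show ?thesis
  proof (induction rule: span_induct_alt)
    case base then show ?case by simp
  next
    case (step c y z)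
    then obtain j where j: "y = b j" by auto
    have "(\<Sum>i\<in>UNIV. (b i \<bullet> (c *\<^sub>R y + z)) *\<^sub>R b i)
        = (\<Sum>i\<in>UNIV. (if i = j then c *\<^sub>R b i else 0)) + (\<Sum>i\<in>UNIV. (b i \<bullet> z) *\<^sub>R b i)"
      unfolding sum.distrib[symmetric]
      by (rule sum.cong) (auto simp: j on inner_add_right scaleR_add_left)
    also have "\<dots> = c *\<^sub>R y + z" using step j by simp
    finally show ?case by simp
  qed
qed

text \<open>
  The fields \<open>frame br e f i\<close> are the left-invariant fields generated by \<open>e i\<close>.
\<close>

lemma frame_left_invariant:
  assumes G: "step2_carnot_algebra br g1 g2"
    and e: "orthonormal_basis e g1" and f: "orthonormal_basis f g2"
  shows "((\<lambda>t. bch_mult br (point e f q) (t *\<^sub>R e i))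
           has_vector_derivative point e f (frame br e f i q)) (at 0)"
proof -
  have b: "bilinear br" and z1: "\<And>X V. X \<in> g1 \<Longrightarrow> V \<in> g2 \<Longrightarrow> br X V = 0"
    using G unfolding step2_carnot_algebra_def by blast+
  note bl = bilinear_simps[OF b]
  have eg: "e i \<in> g1" and fg: "f a \<in> g2" for i a
    using e f span_base unfolding orthonormal_basis_def by blast+
  let ?P = "point e f q"
  have lin: "linear (\<lambda>X. br X (e i))" using b by (auto simp: bilinear_def)
  have "br (f a) (e i) = 0" for a
    by (subst step2_bracket_bracket(4)[OF G]) (simp add: z1[OF eg fg])
  then have "br ?P (e i) = (\<Sum>j\<in>UNIV. fst q $ j *\<^sub>R br (e j) (e i))"
    unfolding point_def
    by (simp add: linear_add[OF lin] linear_sum[OF lin] linear_scale[OF lin])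
  also have "\<dots> = (\<Sum>j\<in>UNIV. - (fst q $ j *\<^sub>R br (e i) (e j)))"
    by (subst step2_bracket_bracket(4)[OF G]) simp
  also have "\<dots> = (\<Sum>j\<in>UNIV. - (fst q $ j *\<^sub>R (\<Sum>a\<in>UNIV. (f a \<bullet> br (e i) (e j)) *\<^sub>R f a)))"
    using orthonormal_basis_expansion[OF f step2_bracket_bracket(1)[OF G]] by simp
  also have "\<dots> = (\<Sum>j\<in>UNIV. \<Sum>a\<in>UNIV. - ((fst q $ j * (f a \<bullet> br (e i) (e j))) *\<^sub>R f a))"
    by (simp add: scaleR_sum_right sum_negf)
  also have "\<dots> = (\<Sum>a\<in>UNIV. \<Sum>j\<in>UNIV. - ((fst q $ j * (f a \<bullet> br (e i) (e j))) *\<^sub>R f a))"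
    by (rule sum.swap)
  finally have br: "(1/2) *\<^sub>R br ?P (e i) = (\<Sum>a\<in>UNIV. snd (frame br e f i q) $ a *\<^sub>R f a)"
    by (simp add: frame_def struct_matrix_def scaleR_sum_right scaleR_sum_left sum_distrib_left
        sum_negf mult_ac sum_divide_distrib)
  have "(\<Sum>j\<in>UNIV. fst (frame br e f i q) $ j *\<^sub>R e j) = e i"
    by (simp add: frame_def axis_def if_distrib[of "\<lambda>c. c *\<^sub>R _"] cong: if_cong)
  then have pt: "point e f (frame br e f i q) = e i + (1/2) *\<^sub>R br ?P (e i)"
    unfolding br by (simp add: point_def)
  have "((\<lambda>t. ?P + t *\<^sub>R (e i + (1/2) *\<^sub>R br ?P (e i)))
      has_vector_derivative e i + (1/2) *\<^sub>R br ?P (e i)) (at 0)"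
    by (auto intro!: derivative_eq_intros)
  then show ?thesis
    unfolding pt bch_mult_def by (simp only: bl scaleR_add_right add.assoc scaleR_left_commute)
qed


section \<open>The sub-Riemannian exponential map\<close>

text \<open>
  Points of the cotangent bundle are pairs \<open>(q, p)\<close>, where \<open>q = (x, z)\<close> are the coordinates of the
  base point and \<open>p\<close> those of the covector with respect to \<open>dx, dz\<close>.
\<close>

definition sr_hamiltonian ::
    "('g::euclidean_space \<Rightarrow> 'g \<Rightarrow> 'g) \<Rightarrow> ('k::finite \<Rightarrow> 'g) \<Rightarrow> ('m::finite \<Rightarrow> 'g) \<Rightarrow>
      ((real^'k) \<times> (real^'m)) \<times> ((real^'k) \<times> (real^'m)) \<Rightarrow> real" where
  "sr_hamiltonian br e f = (\<lambda>(q, p). 1 / 2 * (\<Sum>i\<in>UNIV. (p \<bullet> frame br e f i q)\<^sup>2))"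

definition gradient :: "('a::real_inner \<Rightarrow> real) \<Rightarrow> 'a \<Rightarrow> 'a" where
  "gradient F x = (THE D. GDERIV F x :> D)"

definition hamiltonian_field :: "('a::real_inner \<times> 'a \<Rightarrow> real) \<Rightarrow> 'a \<times> 'a \<Rightarrow> 'a \<times> 'a" where
  "hamiltonian_field H =
     (\<lambda>(q, p). (gradient (\<lambda>p'. H (q, p')) p, - gradient (\<lambda>q'. H (q', p)) q))"

definition sr_exp ::
    "('g::euclidean_space \<Rightarrow> 'g \<Rightarrow> 'g) \<Rightarrow> ('k::finite \<Rightarrow> 'g) \<Rightarrow> ('m::finite \<Rightarrow> 'g) \<Rightarrow>
      (real^'k) \<times> (real^'m) \<Rightarrow> (real^'k) \<times> (real^'m)" where
  "sr_exp br e f l =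
     (THE q. \<exists>\<Gamma> :: real \<Rightarrow> ((real^'k) \<times> (real^'m)) \<times> ((real^'k) \<times> (real^'m)).
        \<Gamma> 0 = ((0, 0), l) \<and>
        (\<forall>t\<in>{0..1}. (\<Gamma> has_vector_derivative hamiltonian_field (sr_hamiltonian br e f) (\<Gamma> t))
                       (at t within {0..1})) \<and>
        q = fst (\<Gamma> 1))"

text \<open>
  Pairs are flattened to vectors indexed by the sum type, so that the library's Jacobian matrix and
  determinant apply.
\<close>

definition flatten :: "(real^'k) \<times> (real^'m) \<Rightarrow> real^('k::finite + 'm::finite)" where
  "flatten q = (\<chi> s. case s of Inl i \<Rightarrow> fst q $ i | Inr a \<Rightarrow> snd q $ a)"

definition unflatten :: "real^('k::finite + 'm::finite) \<Rightarrow> (real^'k) \<times> (real^'m)" where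
  "unflatten y = ((\<chi> i. y $ Inl i), (\<chi> a. y $ Inr a))"

definition sr_jacobian ::
    "('g::euclidean_space \<Rightarrow> 'g \<Rightarrow> 'g) \<Rightarrow> ('k::finite \<Rightarrow> 'g) \<Rightarrow> ('m::finite \<Rightarrow> 'g) \<Rightarrow>
      real^'k \<Rightarrow> real^'m \<Rightarrow> real" where
  "sr_jacobian br e f u v =
     det (jacobian (\<lambda>y. flatten (sr_exp br e f (unflatten y))) (at (flatten (u, v))))"


section \<open>Normal forms and the decomposition of the initial covector\<close>

text \<open>
  Rows and columns are numbered from 0 to \<open>k - 1\<close>; the first \<open>k - 2 * d\<close> belong to the zero
  block and block \<open>i\<close>, for \<open>i = 1, \<dots>, d\<close>, occupies the positions
  \<open>block_pos k d i\<close> and \<open>block_pos k d i + 1\<close>.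
\<close>

definition block_pos :: "nat \<Rightarrow> nat \<Rightarrow> nat \<Rightarrow> nat" where
  "block_pos k d i = k - 2 * d + 2 * (i - 1)"

text \<open>The block matrix with blocks \<open>0\<close>, \<open>\<beta> 1 J\<close>, \<dots>, \<open>\<beta> d J\<close>, where \<open>J\<close> has rows \<open>(0, 1)\<close> and \<open>(-1, 0)\<close>:\<close>

definition skew_normal_form :: "nat \<Rightarrow> nat \<Rightarrow> (nat \<Rightarrow> real) \<Rightarrow> nat \<Rightarrow> nat \<Rightarrow> real" where
  "skew_normal_form k d \<beta> p q =
     (\<Sum>i=1..d. if p = block_pos k d i \<and> q = block_pos k d i + 1 then \<beta> i
                else if p = block_pos k d i + 1 \<and> q = block_pos k d i then - \<beta> i
                else 0)"

text \<open>The block matrix with blocks \<open>0\<close>, \<open>\<beta> 1 I\<close>, \<dots>, \<open>\<beta> d I\<close>, where \<open>I\<close> is the 2 by 2 identity:\<close>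

definition diag_normal_form :: "nat \<Rightarrow> nat \<Rightarrow> (nat \<Rightarrow> real) \<Rightarrow> nat \<Rightarrow> nat \<Rightarrow> real" where
  "diag_normal_form k d \<beta> p q =
     (\<Sum>i=1..d. if p = q \<and> (p = block_pos k d i \<or> p = block_pos k d i + 1) then \<beta> i else 0)"

definition normalizing_basis ::
    "nat \<Rightarrow> real^'k^'k \<Rightarrow> (nat \<Rightarrow> nat \<Rightarrow> real) \<Rightarrow> (nat \<Rightarrow> real^'k::finite) \<Rightarrow> bool" where
  "normalizing_basis k M N w \<longleftrightarrow>
     k = CARD('k) \<and>
     (\<forall>p<k. \<forall>q<k. w p \<bullet> w q = (if p = q then 1 else 0)) \<and>
     (\<forall>p<k. \<forall>q<k. w p \<bullet> (M *v w q) = N p q)"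

text \<open>The component \<open>u_i\<close> of \<open>u\<close> in the \<open>i\<close>-th plane, for \<open>1 \<le> i \<le> d\<close>:\<close>

definition block_component ::
    "nat \<Rightarrow> nat \<Rightarrow> (nat \<Rightarrow> real^'k::finite) \<Rightarrow> real^'k \<Rightarrow> nat \<Rightarrow> real \<times> real" where
  "block_component k d w u i = (u \<bullet> w (block_pos k d i), u \<bullet> w (block_pos k d i + 1))"

text \<open>
  In the next definition \<open>c i\<close> stands for \<open>u_i\<close> and \<open>r\<close> for \<open>|v|\<close>. It is meaningful
  for \<open>r > 0\<close> only.
\<close>

definition jacobian_formula ::
    "nat \<Rightarrow> nat \<Rightarrow> nat \<Rightarrow> (nat \<Rightarrow> real) \<Rightarrow> (nat \<Rightarrow> real \<times> real) \<Rightarrow> real \<Rightarrow> real" where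
  "jacobian_formula n k d \<alpha> c r =
     2 ^ (2 * d) / ((\<Prod>j=1..d. \<alpha> j)\<^sup>2 * r ^ (2 * d + 2))
     * (\<Sum>i=1..d. (norm (c i))\<^sup>2 * ((\<alpha> i * r - sin (\<alpha> i * r)) / (2 * r ^ 3 * \<alpha> i))) ^ (n - k - 1)
     * (\<Sum>i=1..d. (norm (c i))\<^sup>2
          * (\<Prod>j\<in>{1..d} - {i}. (sin (\<alpha> j * r / 2))\<^sup>2)
          * sin (\<alpha> i * r / 2)
          * (sin (\<alpha> i * r / 2) - \<alpha> i * r / 2 * cos (\<alpha> i * r / 2)))"

end

theory Submission
  imports Defs
begin

text \<open>
  On \<open>L_v\<close>-invariant planes the Hamiltonian system is a rotation, so
  \<open>exp_e(u, v) = (F(v) u, \<zeta>(u, v) v)\<close> with \<open>F(v) = (1 - exp(- L_v)) / L_v\<close>. The vertical part is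
  parallel to \<open>v\<close> because \<open>L_w\<close> anticommutes with \<open>L_v\<close> for \<open>w\<close> orthogonal to \<open>v\<close>, and \<open>\<zeta>\<close> depends on
  \<open>v\<close> only through \<open>|v|\<close>. Written with the entire functions \<open>c_n(y) = \<Sum>m. (-y)^m / (2m + n)!\<close> of
  \<open>|v|\<^sup>2 S\<^sup>2\<close>, both parts are smooth, also at \<open>v = 0\<close>. The Jacobian matrix has the blocks \<open>F\<close>, \<open>B\<close>,
  \<open>v a\<^sup>T\<close> and \<open>\<zeta> I + v b\<^sup>T\<close>. Where \<open>F\<close> is invertible, its Schur complement is a rank one perturbation
  of \<open>\<zeta> I\<close>, whence the determinant is \<open>det F \<zeta>^(n-k-1) (\<zeta> + b \<bullet> v - a \<bullet> F\<^sup>-\<^sup>1 B v)\<close>, and only the radial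
  derivative \<open>B v\<close> is needed. The remaining \<open>v\<close> and the limit \<open>v \<rightarrow> 0\<close> follow by continuity of
  the determinant in \<open>v\<close>.
\<close>

section \<open>Block determinants\<close>

text \<open>The decomposition \<open>u = (u_0, ..., u_d)\<close> depends on \<open>v\<close>, is not
  unique and need not vary continuously, so it cannot be differentiated. The analysis therefore
  stays in the fixed basis that diagonalizes \<open>S\<close>, where functions of \<open>S\<close>
  commute with every \<open>L_v\<close> and \<open>v\<close> enters only through \<open>L_v\<close>,
  \<open>|v|^2\<close> and the final factor \<open>v\<close> of the vertical part. The planes return
  at the very end: what is left are quadratic forms \<open>u . g(S) u\<close> with
  \<open>g(0) = 0\<close>, and these equal the sum of \<open>|u_i|^2 g(\<alpha>_i)\<close> for every
  admissible choice of planes. The radial derivative is tractable because the matrices along a ray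
  commute. With \<open>\<theta> = |v| S\<close> one has \<open>F(t v) = exp(- t L_v / 2) sin(t
  \<theta> / 2) / (t \<theta> / 2)\<close>, whose logarithmic derivative at \<open>t = 1\<close> is
  \<open>(\<theta> / 2) cot(\<theta> / 2) - 1 - L_v / 2\<close>. In other directions
  \<open>w\<close> the matrices \<open>L_w\<close> and \<open>L_v\<close> do not commute in general.
  The exponential map is a definite description over integral curves, so uniqueness of the curve has
  to be proved too; skew-symmetry of \<open>L_v\<close> supplies it through a conserved
  distance.\<close>

lemma det_identity_rows_off_range:
  fixes A :: "'a::comm_ring_1^'n^'n" and f :: "'k::finite \<Rightarrow> 'n"
  assumes "inj f" and rows: "\<And>i j. i \<notin> range f \<Longrightarrow> A $ i $ j = (if i = j then 1 else 0)"
  shows "det A = det (\<chi> i j. A $ f i $ f j)"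
proof -
  let ?t = "\<lambda>p. of_int (sign p) * prod (\<lambda>i. A $ i $ p i) UNIV"
  have bij: "bij_betw f UNIV (range f)" using \<open>inj f\<close> by (simp add: bij_betw_def)
  \<comment> \<open>A permutation that moves some index outside \<open>range f\<close> meets a zero
    of an identity row; one that fixes all of them already permutes \<open>range f\<close>.\<close>
  have zero: "?t p = 0" if "p permutes UNIV" "\<not> p permutes range f" for p
  proof -
    have "\<exists>i. i \<notin> range f \<and> p i \<noteq> i"
    proof (rule ccontr)
      assume "\<not> ?thesis"
      then have "p permutes range f"
        using that(1) by - (rule permutes_superset[of p UNIV], auto)
      then show False using that(2) by simp
    qed
    then obtain i where "A $ i $ p i = 0" using rows by metis
    then have "prod (\<lambda>i. A $ i $ p i) UNIV = 0" by (intro prod_zero) auto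
    then show ?thesis by simp
  qed
  have "det A = (\<Sum>p\<in>{p. p permutes range f}. ?t p)"
    unfolding det_def
    by (rule sum.mono_neutral_right) (auto simp: zero intro: permutes_subset)
  also have "\<dots> = (\<Sum>p\<in>{p. p permutes (UNIV::'k set)}. ?t (map_permutation UNIV f p))"
  proof (rule sum.reindex_bij_witness[where i = "map_permutation UNIV f"
        and j = "map_permutation (range f) (inv f)"])
    fix p assume "p \<in> {p. p permutes range f}"
    then have p: "p permutes range f" by simp
    have b': "bij_betw (inv f) (range f) UNIV"
      using \<open>inj f\<close> by (simp add: bij_betw_inv_into[OF bij])
    show "map_permutation UNIV f (map_permutation (range f) (inv f) p) = p"
      by (rule map_permutation_compose_inv[OF b' p]) (auto simp: f_inv_into_f)
    then show "?t (map_permutation UNIV f (map_permutation (range f) (inv f) p)) = ?t p"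
      by simp
    show "map_permutation (range f) (inv f) p \<in> {p. p permutes UNIV}"
      using map_permutation_permutes[OF b' p] by simp
  next
    fix p :: "'k \<Rightarrow> 'k" assume "p \<in> {p. p permutes UNIV}"
    then have p: "p permutes UNIV" by simp
    show "map_permutation (range f) (inv f) (map_permutation UNIV f p) = p"
      by (rule map_permutation_compose_inv[OF bij p]) (simp add: \<open>inj f\<close>)
    show "map_permutation UNIV f p \<in> {p. p permutes range f}"
      using map_permutation_permutes[OF bij p] by simp
  qed
  also have "\<dots> = (\<Sum>p\<in>{p. p permutes (UNIV::'k set)}.
      of_int (sign p) * prod (\<lambda>i. A $ f i $ f (p i)) UNIV)"
  proof (rule sum.cong[OF refl])
    fix p :: "'k \<Rightarrow> 'k" assume "p \<in> {p. p permutes UNIV}"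
    then have p: "p permutes UNIV" by simp
    let ?q = "map_permutation UNIV f p"
    have q: "?q i = i" if "i \<notin> range f" for i
      using map_permutation_permutes[OF bij p] that by (simp add: permutes_def)
    have "prod (\<lambda>i. A $ i $ ?q i) UNIV = prod (\<lambda>i. A $ i $ ?q i) (range f)"
      by (rule prod.mono_neutral_right) (auto simp: q rows)
    also have "\<dots> = prod (\<lambda>i. A $ f i $ ?q (f i)) UNIV"
      using \<open>inj f\<close> by (simp add: prod.reindex)
    also have "\<dots> = prod (\<lambda>i. A $ f i $ f (p i)) UNIV"
      using \<open>inj f\<close> by (simp add: map_permutation_apply)
    finally show "?t ?q = of_int (sign p) * prod (\<lambda>i. A $ f i $ f (p i)) UNIV"
      using \<open>inj f\<close> p by (simp add: sign_map_permutation)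
  qed
  finally show ?thesis by (simp add: det_def)
qed

definition block_matrix ::
    "'a^'k^'k \<Rightarrow> 'a^'m^'k \<Rightarrow> 'a^'k^'m \<Rightarrow> 'a^'m^'m \<Rightarrow> 'a^('k::finite + 'm::finite)^('k + 'm)" where
  "block_matrix A B C D = (\<chi> s t. case s of
     Inl i \<Rightarrow> (case t of Inl j \<Rightarrow> A $ i $ j | Inr b \<Rightarrow> B $ i $ b)
   | Inr a \<Rightarrow> (case t of Inl j \<Rightarrow> C $ a $ j | Inr b \<Rightarrow> D $ a $ b))"

lemma transpose_block_matrix:
  "transpose (block_matrix A B C D) =
     block_matrix (transpose A) (transpose C) (transpose B) (transpose D)"
  by (simp add: vec_eq_iff transpose_def block_matrix_def split: sum.split)

lemma sum_UNIV_Plus: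
  "(\<Sum>s\<in>UNIV. g s) = (\<Sum>i\<in>UNIV. g (Inl i)) + (\<Sum>a\<in>UNIV. g (Inr a))"
  for g :: "'k::finite + 'm::finite \<Rightarrow> 'a::comm_monoid_add"
  unfolding UNIV_Plus_UNIV[symmetric] by (subst sum.Plus) auto

lemma block_matrix_mult:
  "block_matrix A B C D ** block_matrix A' B' C' D' =
     block_matrix (A ** A' + B ** C') (A ** B' + B ** D') (C ** A' + D ** C') (C ** B' + D ** D')"
  by (simp add: vec_eq_iff block_matrix_def matrix_matrix_mult_def sum_UNIV_Plus split: sum.split)

lemma det_block_matrix_identity_lower_right:
  fixes A :: "'a::comm_ring_1^'k^'k" and B :: "'a^'m^'k"
  shows "det (block_matrix A B 0 (mat 1)) = det A"
proof -
  have "det (block_matrix A B 0 (mat 1)) =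
      det (\<chi> i j. block_matrix A B 0 (mat 1) $ (Inl i :: 'k + 'm) $ Inl j)"
    by (rule det_identity_rows_off_range) (auto simp: block_matrix_def mat_def split: sum.split)
  also have "(\<chi> i j. block_matrix A B 0 (mat 1) $ (Inl i :: 'k + 'm) $ Inl j) = A"
    by (simp add: vec_eq_iff block_matrix_def)
  finally show ?thesis .
qed

lemma det_block_matrix_identity_upper_left:
  fixes C :: "'a::comm_ring_1^'k^'m" and D :: "'a^'m^'m"
  shows "det (block_matrix (mat 1) 0 C D) = det D"
proof -
  have "det (block_matrix (mat 1) 0 C D) =
      det (\<chi> i j. block_matrix (mat 1) 0 C D $ (Inr i :: 'k + 'm) $ Inr j)"
    by (rule det_identity_rows_off_range) (auto simp: block_matrix_def mat_def split: sum.split)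
  also have "(\<chi> i j. block_matrix (mat 1) 0 C D $ (Inr i :: 'k + 'm) $ Inr j) = D"
    by (simp add: vec_eq_iff block_matrix_def)
  finally show ?thesis .
qed

lemma transpose_zero [simp]: "transpose (0 :: 'a::zero^'n^'m) = 0"
  by (simp add: transpose_def vec_eq_iff)

lemma det_block_matrix_lower:
  fixes A :: "'a::comm_ring_1^'k^'k" and C :: "'a^'k^'m"
  shows "det (block_matrix A 0 C (mat 1)) = det A"
  using det_transpose[of "block_matrix A 0 C (mat 1)"]
  by (simp add: transpose_block_matrix det_block_matrix_identity_lower_right)

lemma det_block_matrix_upper:
  fixes B :: "'a::comm_ring_1^'m^'k" and D :: "'a^'m^'m"
  shows "det (block_matrix (mat 1) B 0 D) = det D"
  using det_transpose[of "block_matrix (mat 1) B 0 D"]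
  by (simp add: transpose_block_matrix det_block_matrix_identity_upper_left)

text \<open>Block LU factorization. A solution \<open>G\<close> of \<open>A ** G = B\<close> takes
  the place of the inverse of \<open>A\<close> times \<open>B\<close>, so the identity holds over
  any commutative ring.\<close>

lemma det_block_matrix_schur:
  fixes A :: "'a::comm_ring_1^'k^'k" and D :: "'a^'m^'m"
  assumes "A ** G = B"
  shows "det (block_matrix A B C D) = det A * det (D - C ** G)"
proof -
  have "block_matrix A B C D = block_matrix A 0 C (mat 1) ** block_matrix (mat 1) G 0 (D - C ** G)"
    by (simp add: block_matrix_mult assms)
  then show ?thesis
    by (simp add: det_mul det_block_matrix_lower det_block_matrix_upper)
qed

section \<open>Rank one perturbations of a scalar matrix\<close>

definition outer :: "real^'m \<Rightarrow> real^'n \<Rightarrow> real^'n^'m" where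
  "outer v c = (\<chi> i j. v $ i * c $ j)"

lemma outer_minus_right: "outer v b - outer v c = outer v (b - c)"
  by (simp add: outer_def vec_eq_iff algebra_simps)

lemma outer_matrix_mult: "outer v a ** G = outer v (transpose G *v a)"
  by (simp add: outer_def vec_eq_iff matrix_matrix_mult_def matrix_vector_mult_def transpose_def
      sum_distrib_left mult_ac)

text \<open>
  For \<open>x \<noteq> 0\<close> the block matrix with blocks \<open>x I\<close>, \<open>v\<close>, \<open>c\<close> and \<open>- 1\<close> can be eliminated from either
  corner; the case \<open>x = 0\<close> follows by continuity in \<open>x\<close>.
\<close>

lemma det_scalar_plus_outer_nonzero:
  fixes v c :: "real^'m"
  assumes "x \<noteq> 0"
  shows "det (x *\<^sub>R mat 1 + outer v c) = x ^ (CARD('m) - 1) * (x + c \<bullet> v)"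
proof -
  let ?v = "(\<chi> i j. v $ i) :: real^1^'m" and ?c = "(\<chi> i j. - c $ j) :: real^'m^1"
  let ?b = "block_matrix (x *\<^sub>R mat 1) ?v ?c (mat 1)"
  have cv: "?v ** ?c = - outer v c"
    by (simp add: vec_eq_iff matrix_matrix_mult_def outer_def)
  have "?b = block_matrix (mat 1) ?v 0 (mat 1) ** block_matrix (x *\<^sub>R mat 1 + outer v c) 0 ?c (mat 1)"
    by (simp add: block_matrix_mult cv)
  then have 1: "det ?b = det (x *\<^sub>R mat 1 + outer v c)"
    by (simp only: det_mul det_block_matrix_upper det_block_matrix_lower det_I mult_1)
  have "(x *\<^sub>R mat 1) ** ((1 / x) *\<^sub>R ?v) = ?v"
    using assms by (simp only: scalar_matrix_assoc[symmetric] matrix_mul_lid) simp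
  then have "det ?b = det (x *\<^sub>R mat 1 :: real^'m^'m) * det (mat 1 - ?c ** ((1 / x) *\<^sub>R ?v))"
    by (rule det_block_matrix_schur)
  also have "det (x *\<^sub>R mat 1 :: real^'m^'m) = x ^ CARD('m)"
    by (subst det_diagonal) (auto simp: mat_def)
  also have "det (mat 1 - ?c ** ((1 / x) *\<^sub>R ?v)) = 1 + (c \<bullet> v) / x"
    by (simp add: det_1 mat_def matrix_matrix_mult_def inner_vec_def sum_negf sum_divide_distrib
        mult_ac)
  also have "x ^ CARD('m) * (1 + (c \<bullet> v) / x) = x ^ (CARD('m) - 1) * (x + c \<bullet> v)"
    using assms by (cases "CARD('m)") (auto simp: field_simps)
  finally show ?thesis using 1 by simp
qed

lemma continuous_on_det:
  fixes A :: "'a::topological_space \<Rightarrow> real^'n^'n"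
  assumes "\<And>i j. continuous_on X (\<lambda>x. A x $ i $ j)"
  shows "continuous_on X (\<lambda>x. det (A x))"
  unfolding det_def by (intro continuous_intros assms)

text \<open>A non-empty open set of reals is uncountable, so it cannot lie inside \<open>Z\<close>.
  This removes the exceptional value \<open>x = 0\<close> below and, later, the zeros of the sines
  along a ray.\<close>

lemma continuous_eq_off_countable:
  fixes f g :: "real \<Rightarrow> real"
  assumes f: "continuous_on X f" and g: "continuous_on X g" and "open X" "x \<in> X"
    and Z: "countable Z" and eq: "\<And>x. x \<in> X \<Longrightarrow> x \<notin> Z \<Longrightarrow> f x = g x"
  shows "f x = g x"
proof (rule ccontr)
  assume neq: "f x \<noteq> g x"
  let ?U = "X \<inter> (\<lambda>x. f x - g x) -` (- {0})"
  have "open ?U"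
    by (rule continuous_open_preimage[OF continuous_on_diff[OF f g] \<open>open X\<close>])
      (rule open_Compl[OF closed_singleton])
  moreover have "?U \<noteq> {}"
    using neq \<open>x \<in> X\<close> by (intro ex_in_conv[THEN iffD1] exI[of _ x]) auto
  ultimately have "\<exists>y\<in>?U. y \<notin> Z" by (intro open_minus_countable Z)
  then obtain y where "y \<in> ?U" "y \<notin> Z" ..
  then show False using eq[of y] by auto
qed

lemma det_scalar_plus_outer:
  fixes v c :: "real^'m"
  shows "det (x *\<^sub>R mat 1 + outer v c) = x ^ (CARD('m) - 1) * (x + c \<bullet> v)"
proof (rule continuous_eq_off_countable[where X = UNIV and Z = "{0}"
      and f = "\<lambda>x. det (x *\<^sub>R mat 1 + outer v c)"
      and g = "\<lambda>x. x ^ (CARD('m) - 1) * (x + c \<bullet> v)"])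
  show "continuous_on UNIV (\<lambda>x. det (x *\<^sub>R mat 1 + outer v c))"
    by (intro continuous_on_det) (auto intro!: continuous_intros)
qed (auto intro!: continuous_intros simp: det_scalar_plus_outer_nonzero)

section \<open>Stumpff functions\<close>

definition stumpff_coeff :: "nat \<Rightarrow> nat \<Rightarrow> real" where
  "stumpff_coeff n m = (- 1) ^ m / fact (2 * m + n)"

text \<open>At \<open>y = x^2\<close> the functions for \<open>n = 0, 1, 2, 3\<close> are
  \<open>cos x\<close>, \<open>sin x / x\<close>, \<open>(1 - cos x) / x^2\<close> and
  \<open>(x - sin x) / x^3\<close>, with the singularities at \<open>x = 0\<close> removed.\<close>

definition stumpff :: "nat \<Rightarrow> real \<Rightarrow> real" where
  "stumpff n y = (\<Sum>m. stumpff_coeff n m * y ^ m)"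

definition stumpff_deriv :: "nat \<Rightarrow> real \<Rightarrow> real" where
  "stumpff_deriv n y = (\<Sum>m. diffs (stumpff_coeff n) m * y ^ m)"

lemma summable_stumpff: "summable (\<lambda>m. stumpff_coeff n m * y ^ m)"
proof (rule summable_comparison_test')
  show "summable (\<lambda>m. inverse (fact m) * \<bar>y\<bar> ^ m)" by (rule summable_exp)
  show "norm (stumpff_coeff n m * y ^ m) \<le> inverse (fact m) * \<bar>y\<bar> ^ m" if "0 \<le> m" for m
  proof -
    have "(fact m :: real) \<le> fact (2 * m + n)" by (rule fact_mono) simp
    then have "inverse (fact (2 * m + n)) \<le> inverse (fact m :: real)"
      by (intro le_imp_inverse_le) auto
    then show ?thesis
      by (auto simp: stumpff_coeff_def abs_mult power_abs divide_inverse intro!: mult_right_mono)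
  qed
qed

lemma summable_stumpff_deriv: "summable (\<lambda>m. diffs (stumpff_coeff n) m * y ^ m)"
  by (rule termdiff_converges_all) (rule summable_stumpff)

lemma has_real_derivative_stumpff:
  "(stumpff n has_real_derivative stumpff_deriv n y) (at y)"
  unfolding stumpff_def[abs_def] stumpff_deriv_def
  by (rule termdiffs_strong_converges_everywhere) (rule summable_stumpff)

lemmas has_real_derivative_stumpff_comp [derivative_intros] =
  DERIV_chain2[OF has_real_derivative_stumpff]

lemmas has_derivative_stumpff_comp [derivative_intros] =
  has_real_derivative_stumpff[THEN DERIV_compose_FDERIV]

lemma continuous_on_stumpff [continuous_intros]:
  "continuous_on X g \<Longrightarrow> continuous_on X (\<lambda>x. stumpff n (g x))"
  using DERIV_continuous_on[of UNIV "stumpff n" "stumpff_deriv n"] has_real_derivative_stumpff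
  by (intro continuous_on_compose2[of UNIV "stumpff n" X g]) auto

lemma continuous_on_stumpff_deriv [continuous_intros]:
  "continuous_on X g \<Longrightarrow> continuous_on X (\<lambda>x. stumpff_deriv n (g x))"
proof -
  have "(stumpff_deriv n has_real_derivative
      (\<Sum>m. diffs (diffs (stumpff_coeff n)) m * y ^ m)) (at y)" for y
    unfolding stumpff_deriv_def[abs_def]
    by (rule termdiffs_strong_converges_everywhere) (rule summable_stumpff_deriv)
  then have "continuous_on UNIV (stumpff_deriv n)"
    by (rule DERIV_continuous_on)
  then show "continuous_on X g \<Longrightarrow> continuous_on X (\<lambda>x. stumpff_deriv n (g x))"
    by (intro continuous_on_compose2[of UNIV "stumpff_deriv n" X g]) auto
qed

lemma stumpff_0: "stumpff n 0 = 1 / fact n"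
  unfolding stumpff_def by (subst powser_zero) (simp add: stumpff_coeff_def)

lemma stumpff_recurrence: "stumpff n y = 1 / fact n - y * stumpff (n + 2) y"
proof -
  have "stumpff n y = stumpff_coeff n 0 * y ^ 0 + (\<Sum>m. stumpff_coeff n (Suc m) * y ^ Suc m)"
    unfolding stumpff_def by (rule suminf_split_head[OF summable_stumpff, symmetric, simplified
        diff_eq_eq, THEN trans]) (simp add: add.commute)
  also have "(\<lambda>m. stumpff_coeff n (Suc m) * y ^ Suc m) =
      (\<lambda>m. - y * (stumpff_coeff (n + 2) m * y ^ m))"
    by (simp add: stumpff_coeff_def fun_eq_iff)
  also have "(\<Sum>m. - y * (stumpff_coeff (n + 2) m * y ^ m)) = - y * stumpff (n + 2) y"
    unfolding stumpff_def by (rule suminf_mult[OF summable_stumpff])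
  finally show ?thesis by (simp add: stumpff_coeff_def)
qed

lemma stumpff_deriv_sums:
  "(\<lambda>m. real m * stumpff_coeff n m * y ^ m) sums (y * stumpff_deriv n y)"
proof -
  have "(\<lambda>m. y * (real m * stumpff_coeff n m * y ^ (m - Suc 0))) sums (y * stumpff_deriv n y)"
    unfolding stumpff_deriv_def by (intro sums_mult diffs_equiv summable_stumpff_deriv)
  also have "(\<lambda>m. y * (real m * stumpff_coeff n m * y ^ (m - Suc 0))) =
      (\<lambda>m. real m * stumpff_coeff n m * y ^ m)"
  proof
    \<comment> \<open>At \<open>m = 0\<close> the truncated exponent \<open>m - Suc 0\<close> does
      no harm because of the factor \<open>real m\<close>.\<close>
    fix m show "y * (real m * stumpff_coeff n m * y ^ (m - Suc 0)) = real m * stumpff_coeff n m * y ^ m"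
      by (cases m) auto
  qed
  finally show ?thesis .
qed

text \<open>Coefficientwise this is \<open>(2m + n + 1)! = (2m + n + 1) (2m + n)!\<close>. Kept free
  of division by \<open>y\<close>, it covers \<open>y = 0\<close>, and it later eliminates the
  derivatives of Stumpff functions from all radial derivatives.\<close>

lemma stumpff_deriv_Suc:
  "2 * y * stumpff_deriv (Suc n) y = stumpff n y - real (Suc n) * stumpff (Suc n) y"
proof -
  have "(\<lambda>m. 2 * (real m * stumpff_coeff (Suc n) m * y ^ m)
      + real (Suc n) * (stumpff_coeff (Suc n) m * y ^ m))
    sums (2 * (y * stumpff_deriv (Suc n) y) + real (Suc n) * stumpff (Suc n) y)"
    unfolding stumpff_def[of "Suc n"]
    by (intro sums_add sums_mult stumpff_deriv_sums summable_sums summable_stumpff)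
  also have "(\<lambda>m. 2 * (real m * stumpff_coeff (Suc n) m * y ^ m)
      + real (Suc n) * (stumpff_coeff (Suc n) m * y ^ m)) = (\<lambda>m. stumpff_coeff n m * y ^ m)"
  proof
    fix m
    have "stumpff_coeff n m = (2 * real m + real (Suc n)) * stumpff_coeff (Suc n) m"
      by (simp add: stumpff_coeff_def divide_simps)
    then show "2 * (real m * stumpff_coeff (Suc n) m * y ^ m)
        + real (Suc n) * (stumpff_coeff (Suc n) m * y ^ m) = stumpff_coeff n m * y ^ m"
      by (simp add: algebra_simps)
  qed
  finally have "2 * (y * stumpff_deriv (Suc n) y) + real (Suc n) * stumpff (Suc n) y = stumpff n y"
    unfolding stumpff_def[of n] by (metis sums_unique)
  then show ?thesis by simp
qed

text \<open>The bottom of the ladder, the analogue of \<open>cos' = - sin\<close>: differentiation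
  shifts the index, and its factor \<open>m + 1\<close> cancels against
  \<open>(2m + 2)! = (2m + 2) (2m + 1)!\<close>.\<close>

lemma stumpff_deriv_0: "2 * stumpff_deriv 0 y = - stumpff 1 y"
proof -
  have "2 * (diffs (stumpff_coeff 0) m * y ^ m) = - (stumpff_coeff 1 m * y ^ m)" for m
  proof -
    have "fact (2 * Suc m) = (2 * real (Suc m)) * fact (2 * m + 1)"
      by (simp add: algebra_simps)
    then have "2 * diffs (stumpff_coeff 0) m = - stumpff_coeff 1 m"
      by (simp add: diffs_def stumpff_coeff_def divide_simps del: fact_Suc)
    then show ?thesis by (metis mult.assoc mult_minus_left)
  qed
  then have "(\<Sum>m. 2 * (diffs (stumpff_coeff 0) m * y ^ m)) = (\<Sum>m. - (stumpff_coeff 1 m * y ^ m))"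
    by simp
  then show ?thesis
    unfolding stumpff_def stumpff_deriv_def
    by (simp only: suminf_mult[OF summable_stumpff_deriv] suminf_minus[OF summable_stumpff])
qed

section \<open>Trigonometric identities for Stumpff functions\<close>

lemma stumpff_0_square: "stumpff 0 (x\<^sup>2) = cos x"
  unfolding stumpff_def stumpff_coeff_def
  using sums_unique[OF cos_paired[of x]] by (simp add: power_mult)

lemma stumpff_1_square: "x * stumpff 1 (x\<^sup>2) = sin x"
proof -
  have "x * stumpff 1 (x\<^sup>2) = (\<Sum>m. x * (stumpff_coeff 1 m * (x\<^sup>2) ^ m))"
    unfolding stumpff_def by (rule suminf_mult[OF summable_stumpff, symmetric])
  also have "\<dots> = (\<Sum>m. (- 1) ^ m / fact (2 * m + 1) * x ^ (2 * m + 1))"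
    by (simp add: stumpff_coeff_def power_mult[symmetric] mult_ac)
  also have "\<dots> = sin x"
    using sums_unique[OF sin_paired[of x]] by simp
  finally show ?thesis .
qed

lemma stumpff_2_square: "x\<^sup>2 * stumpff 2 (x\<^sup>2) = 1 - cos x"
  using stumpff_recurrence[of 0 "x\<^sup>2"] by (simp add: stumpff_0_square flip: numeral_2_eq_2)

lemma stumpff_3_square: "x ^ 3 * stumpff 3 (x\<^sup>2) = x - sin x"
proof -
  have "sin x = x * (1 - x\<^sup>2 * stumpff 3 (x\<^sup>2))"
    using stumpff_recurrence[of 1 "x\<^sup>2"] stumpff_1_square[of x] by (simp add: numeral_3_eq_3)
  then show ?thesis by (simp add: algebra_simps power2_eq_square power3_eq_cube)
qed

text \<open>For \<open>y = x^2\<close> the second identity is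
  \<open>sin^2 x - cos x (1 - cos x) = 1 - cos x\<close> divided by \<open>x^2\<close>. It
  simplifies the area swept out by a geodesic.\<close>

lemma stumpff_pythagoras:
  assumes "0 \<le> y"
  shows "(stumpff 0 y)\<^sup>2 + y * (stumpff 1 y)\<^sup>2 = 1"
    and "(stumpff 1 y)\<^sup>2 - stumpff 0 y * stumpff 2 y = stumpff 2 y"
proof -
  obtain x where x: "y = x\<^sup>2" using assms by (metis real_sqrt_pow2)
  have *: "y * (stumpff 1 y)\<^sup>2 = (sin x)\<^sup>2"
    unfolding x stumpff_1_square[symmetric] by (simp add: power_mult_distrib)
  show "(stumpff 0 y)\<^sup>2 + y * (stumpff 1 y)\<^sup>2 = 1"
    unfolding * unfolding x stumpff_0_square by simp
  show "(stumpff 1 y)\<^sup>2 - stumpff 0 y * stumpff 2 y = stumpff 2 y"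
  proof (cases "y = 0")
    case False
    have "y * ((stumpff 1 y)\<^sup>2 - stumpff 0 y * stumpff 2 y)
        = (sin x)\<^sup>2 - cos x * (1 - cos x)"
      unfolding stumpff_2_square[symmetric] *[symmetric]
      by (simp only: x stumpff_0_square) (simp add: algebra_simps)
    also have "\<dots> = 1 - cos x" by (simp add: sin_squared_eq algebra_simps power2_eq_square)
    also have "\<dots> = y * stumpff 2 y" using stumpff_2_square[of x] by (simp add: x)
    finally show ?thesis using False by simp
  qed (simp add: stumpff_0 fact_numeral)
qed

text \<open>Double-angle formulas for \<open>y = (2 x)^2\<close>, whence the argument
  \<open>y / 4 = x^2\<close>.\<close>

lemma stumpff_half_angle:
  assumes "0 \<le> y"
  shows "stumpff 0 y = (stumpff 0 (y / 4))\<^sup>2 - y / 4 * (stumpff 1 (y / 4))\<^sup>2"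
    and "stumpff 1 y = stumpff 0 (y / 4) * stumpff 1 (y / 4)"
    and "stumpff 2 y = (stumpff 1 (y / 4))\<^sup>2 / 2"
proof -
  obtain x where x: "y = (2 * x)\<^sup>2"
    using real_sqrt_pow2[OF assms] by (metis mult.commute nonzero_mult_div_cancel_right
        times_divide_eq_right zero_neq_numeral)
  then have x4: "y / 4 = x\<^sup>2" by (simp add: power_mult_distrib)
  have *: "x\<^sup>2 * (stumpff 1 (x\<^sup>2))\<^sup>2 = (sin x)\<^sup>2"
    unfolding stumpff_1_square[symmetric] by (simp add: power_mult_distrib)
  show "stumpff 0 y = (stumpff 0 (y / 4))\<^sup>2 - y / 4 * (stumpff 1 (y / 4))\<^sup>2"
    unfolding x4 * unfolding x stumpff_0_square by (rule cos_double)
  show "stumpff 1 y = stumpff 0 (y / 4) * stumpff 1 (y / 4)"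
  proof (cases "x = 0")
    case False
    have "2 * x * stumpff 1 y = 2 * (x * stumpff 1 (x\<^sup>2)) * cos x"
      unfolding x stumpff_1_square by (rule sin_double)
    then show ?thesis using False by (simp add: x4 stumpff_0_square)
  qed (simp add: x stumpff_0)
  show "stumpff 2 y = (stumpff 1 (y / 4))\<^sup>2 / 2"
  proof (cases "x = 0")
    case False
    have "(2 * x)\<^sup>2 * stumpff 2 y = 2 * (sin x)\<^sup>2"
      unfolding x stumpff_2_square by (simp add: cos_double_sin)
    then have "x\<^sup>2 * (4 * stumpff 2 y) = x\<^sup>2 * (2 * (stumpff 1 (x\<^sup>2))\<^sup>2)"
      by (simp add: *[symmetric] power_mult_distrib)
    then show ?thesis using False by (simp add: x4)
  qed (simp add: x stumpff_0 fact_numeral)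
qed

text \<open>The functions \<open>t^n c_n(a t^2)\<close> are successive antiderivatives; this chain
  integrates velocity to position, and the swept area to height.\<close>

lemma has_real_derivative_power_stumpff:
  "((\<lambda>t. t ^ Suc n * stumpff (Suc n) (a * t\<^sup>2)) has_real_derivative
     t ^ n * stumpff n (a * t\<^sup>2)) (at t)"
proof -
  have "((\<lambda>t. t ^ Suc n) has_real_derivative real (Suc n) * t ^ n) (at t)"
    using DERIV_pow[of "Suc n" t] by simp
  moreover have "((\<lambda>t. stumpff (Suc n) (a * t\<^sup>2)) has_real_derivative
      stumpff_deriv (Suc n) (a * t\<^sup>2) * (a * (2 * t))) (at t)"
    by (auto intro!: derivative_eq_intros)
  ultimately have "((\<lambda>t. t ^ Suc n * stumpff (Suc n) (a * t\<^sup>2)) has_real_derivative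
      real (Suc n) * t ^ n * stumpff (Suc n) (a * t\<^sup>2)
        + stumpff_deriv (Suc n) (a * t\<^sup>2) * (a * (2 * t)) * t ^ Suc n) (at t)"
    by (rule DERIV_mult)
  also have "real (Suc n) * t ^ n * stumpff (Suc n) (a * t\<^sup>2)
        + stumpff_deriv (Suc n) (a * t\<^sup>2) * (a * (2 * t)) * t ^ Suc n
      = t ^ n * (real (Suc n) * stumpff (Suc n) (a * t\<^sup>2)
        + 2 * (a * t\<^sup>2) * stumpff_deriv (Suc n) (a * t\<^sup>2))"
    by (simp add: algebra_simps power2_eq_square)
  also have "\<dots> = t ^ n * stumpff n (a * t\<^sup>2)"
    by (subst stumpff_deriv_Suc) simp
  finally show ?thesis .
qed

lemma has_real_derivative_stumpff_0:
  "((\<lambda>t. stumpff 0 (a * t\<^sup>2)) has_real_derivative - a * t * stumpff 1 (a * t\<^sup>2)) (at t)"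
proof -
  have "((\<lambda>t. stumpff 0 (a * t\<^sup>2)) has_real_derivative
      stumpff_deriv 0 (a * t\<^sup>2) * (a * (2 * t))) (at t)"
    by (auto intro!: derivative_eq_intros)
  also have "stumpff_deriv 0 (a * t\<^sup>2) * (a * (2 * t)) = a * t * (2 * stumpff_deriv 0 (a * t\<^sup>2))"
    by simp
  finally show ?thesis by (simp only: stumpff_deriv_0) simp
qed

section \<open>The matrices of a generalized H-type algebra\<close>

lemma has_derivative_vec_lambda:
  fixes f :: "'a::real_normed_vector \<Rightarrow> 'n::finite \<Rightarrow> 'b::euclidean_space"
  assumes "\<And>i. ((\<lambda>x. f x i) has_derivative f' i) F"
  shows "((\<lambda>x. \<chi> i. f x i) has_derivative (\<lambda>h. \<chi> i. f' i h)) F"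
proof -
  have lin: "bounded_linear (f' i)"
    and lim: "((\<lambda>y. ((f y i - f (Lim F (\<lambda>x. x)) i) - f' i (y - Lim F (\<lambda>x. x))) /\<^sub>R
        norm (y - Lim F (\<lambda>x. x))) \<longlongrightarrow> 0) F" for i
    using assms[of i] by (auto simp: has_derivative_def)
  have "bounded_linear (\<lambda>h. \<chi> i. f' i h)"
  proof (rule bounded_linear_intro)
    fix x
    have "norm (\<chi> i. f' i x) \<le> (\<Sum>i\<in>UNIV. norm (f' i x))"
      using norm_le_l1_cart[of "\<chi> i. norm (f' i x)"] by (simp add: norm_vec_def L2_set_def)
    also have "\<dots> \<le> (\<Sum>i\<in>UNIV. norm x * onorm (f' i))"
      by (intro sum_mono) (metis onorm[OF lin] mult.commute)
    finally show "norm (\<chi> i. f' i x) \<le> norm x * (\<Sum>i\<in>UNIV. onorm (f' i))"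
      by (simp add: sum_distrib_left)
  qed (simp_all add: vec_eq_iff linear_simps[OF lin])
  moreover have "((\<lambda>y. (((\<chi> i. f y i) - (\<chi> i. f (Lim F (\<lambda>x. x)) i)) - (\<chi> i. f' i (y - Lim F (\<lambda>x. x)))) /\<^sub>R
        norm (y - Lim F (\<lambda>x. x))) \<longlongrightarrow> 0) F"
    by (rule vec_tendstoI) (use lim in simp)
  ultimately show ?thesis by (simp add: has_derivative_def)
qed

text \<open>
  For \<open>L v\<close> the matrix of \<open>J_v\<close> and \<open>s i\<close> the eigenvalues of \<open>S\<close>: the last assumption is the
  polarized form of \<open>L_v\<^sup>2 = - |v|\<^sup>2 S\<^sup>2\<close>.
\<close>

locale htype_matrices =
  fixes s :: "'k::finite \<Rightarrow> real" and L :: "real^'m::finite \<Rightarrow> real^'k^'k"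
  assumes s_nonneg: "0 \<le> s i"
    and linear_L: "linear L"
    and skew: "L v $ j $ i = - L v $ i $ j"
    and anticommute: "L v *v (L w *v x) + L w *v (L v *v x) =
      (- 2 * (v \<bullet> w)) *\<^sub>R (\<chi> i. (s i)\<^sup>2 * x $ i)"
begin

text \<open>\<open>fc \<phi>\<close> is \<open>\<phi>(S)\<close> in the sense of the functional calculus.\<close>

definition fc :: "(real \<Rightarrow> real) \<Rightarrow> real^'k \<Rightarrow> real^'k" where
  "fc \<phi> x = (\<chi> i. \<phi> (s i) * x $ i)"

lemma fc_nth: "fc \<phi> x $ i = \<phi> (s i) * x $ i"
  by (simp add: fc_def)

lemma fc_fc: "fc \<phi> (fc \<psi> x) = fc (\<lambda>a. \<phi> a * \<psi> a) x"
  by (simp add: fc_def vec_eq_iff)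

lemma linear_fc: "linear (fc \<phi>)"
  by (rule linearI) (simp_all add: fc_def vec_eq_iff algebra_simps)

lemmas fc_linear_simps =
  linear_add[OF linear_fc] linear_diff[OF linear_fc] linear_neg[OF linear_fc]
  linear_scale[OF linear_fc] linear_0[OF linear_fc]

lemma inner_fc_left: "fc \<phi> x \<bullet> y = x \<bullet> fc \<phi> y"
  by (simp add: fc_def inner_vec_def mult_ac)

lemma fc_inner_self: "x \<bullet> fc \<phi> x = (\<Sum>i\<in>UNIV. \<phi> (s i) * (x $ i)\<^sup>2)"
  by (simp add: fc_def inner_vec_def power2_eq_square mult_ac)

lemmas L_linear_simps =
  matrix_vector_right_distrib matrix_vector_mult_diff_distrib matrix_vector_mult_scaleR
  matrix_vector_mult_0_right

lemma inner_L_left: "(L v *v x) \<bullet> y = - (x \<bullet> (L v *v y))"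
proof -
  have "transpose (L v) = - L v"
    by (auto simp: vec_eq_iff transpose_def intro: skew)
  moreover have "(- L v) *v x = - (L v *v x)"
    by (simp add: vec_eq_iff matrix_vector_mult_def sum_negf)
  ultimately have "L v *v x = - (x v* L v)"
    using transpose_matrix_vector[of "L v" x] by (metis minus_minus)
  then show ?thesis by (simp add: dot_lmul_matrix)
qed

lemma L_inner_self: "x \<bullet> (L v *v x) = 0"
  using inner_L_left[of v x x] by (simp add: inner_commute)

lemma L_squared: "L v *v (L v *v x) = - (v \<bullet> v) *\<^sub>R fc (\<lambda>a. a\<^sup>2) x"
proof -
  have "2 *\<^sub>R (L v *v (L v *v x)) = 2 *\<^sub>R (- (v \<bullet> v) *\<^sub>R fc (\<lambda>a. a\<^sup>2) x)"
    using anticommute[of v v x] by (simp add: scaleR_2 fc_def)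
  then show ?thesis by (simp only: scaleR_cancel_left) simp
qed

lemma L_zero: "L 0 = 0"
  using linear_L by (rule linear_0)

text \<open>\<open>L v\<close> commutes with its own square, which is a non-zero multiple of
  \<open>S^2\<close>. Comparing entries gives \<open>(s i)^2 = (s j)^2\<close>, and eigenvalues are
  non-negative.\<close>

lemma L_nonzero_entry:
  assumes "L v $ i $ j \<noteq> 0"
  shows "s i = s j"
proof -
  have "v \<noteq> 0" using assms L_zero by auto
  have "- (v \<bullet> v) *\<^sub>R fc (\<lambda>a. a\<^sup>2) (L v *v x) = - (v \<bullet> v) *\<^sub>R (L v *v fc (\<lambda>a. a\<^sup>2) x)" for x
  proof -
    have "- (v \<bullet> v) *\<^sub>R fc (\<lambda>a. a\<^sup>2) (L v *v x) = L v *v (L v *v (L v *v x))"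
      by (rule L_squared[symmetric])
    also have "\<dots> = - (v \<bullet> v) *\<^sub>R (L v *v fc (\<lambda>a. a\<^sup>2) x)"
      by (subst L_squared) (simp only: matrix_vector_mult_scaleR)
    finally show ?thesis .
  qed
  then have "fc (\<lambda>a. a\<^sup>2) (L v *v x) = L v *v fc (\<lambda>a. a\<^sup>2) x" for x
    using \<open>v \<noteq> 0\<close> by (simp del: scaleR_minus_left)
  from arg_cong[OF this[of "axis j 1"], of "\<lambda>y. y $ i"]
  have "(s i)\<^sup>2 * L v $ i $ j = L v $ i $ j * (s j)\<^sup>2"
    by (simp add: fc_def matrix_vector_mult_def axis_def if_distrib cong: if_cong)
  then show ?thesis
    using assms s_nonneg by (simp add: power2_eq_iff_nonneg)
qed

text \<open>\<open>L v\<close> links only indices with equal eigenvalues, so it commutes with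
  \<open>\<phi>(S)\<close> for an arbitrary function \<open>\<phi>\<close>, polynomial or
  not.\<close>

lemma L_fc: "L v *v fc \<phi> x = fc \<phi> (L v *v x)"
proof -
  have "L v $ i $ j * (\<phi> (s j) * x $ j) = \<phi> (s i) * (L v $ i $ j * x $ j)" for i j
    using L_nonzero_entry[of v i j] by (cases "L v $ i $ j = 0") auto
  then show ?thesis
    by (simp only: fc_def matrix_vector_mult_def vec_eq_iff sum_distrib_left vec_lambda_beta) simp
qed

text \<open>The product of the symmetric \<open>\<phi>(S)\<close> and the skew \<open>L v\<close> is
  skew, because the two commute.\<close>

lemma inner_fc_L_swap: "x \<bullet> fc \<phi> (L v *v y) = - (y \<bullet> fc \<phi> (L v *v x))"
proof -
  have "x \<bullet> fc \<phi> (L v *v y) = fc \<phi> x \<bullet> (L v *v y)" by (simp only: inner_fc_left)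
  also have "\<dots> = - ((L v *v fc \<phi> x) \<bullet> y)" by (simp only: inner_L_left minus_minus)
  also have "\<dots> = - (y \<bullet> fc \<phi> (L v *v x))" by (simp only: L_fc inner_commute)
  finally show ?thesis .
qed

lemma inner_fc_L_self: "x \<bullet> fc \<phi> (L v *v x) = 0"
  using inner_fc_L_swap[of x \<phi> v x] by simp

text \<open>A quadratic form sees only the symmetric part of \<open>\<phi>(S) L_v L_w\<close>, which
  is half of \<open>\<phi>(S)\<close> times the anticommutator.\<close>

lemma inner_fc_L_L: "x \<bullet> fc \<phi> (L v *v (L w *v x)) = - (v \<bullet> w) * (x \<bullet> fc (\<lambda>a. \<phi> a * a\<^sup>2) x)"
proof -
  have "x \<bullet> fc \<phi> (L v *v (L w *v x)) = - ((L w *v x) \<bullet> fc \<phi> (L v *v x))"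
    by (rule inner_fc_L_swap)
  also have "\<dots> = - ((L v *v x) \<bullet> fc \<phi> (L w *v x))"
    by (metis inner_commute inner_fc_left)
  also have "\<dots> = x \<bullet> fc \<phi> (L w *v (L v *v x))"
    by (simp only: inner_fc_L_swap[of x] minus_minus)
  finally have "2 * (x \<bullet> fc \<phi> (L v *v (L w *v x))) =
      x \<bullet> fc \<phi> (L v *v (L w *v x) + L w *v (L v *v x))"
    by (simp add: fc_linear_simps inner_add_right)
  also have "L v *v (L w *v x) + L w *v (L v *v x) = (- 2 * (v \<bullet> w)) *\<^sub>R fc (\<lambda>a. a\<^sup>2) x"
    using anticommute[of v w x] by (simp add: fc_def)
  finally show ?thesis by (simp add: fc_linear_simps fc_fc)
qed

text \<open>Moving the outer \<open>L v\<close> to the left factor leaves the skew form of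
  \<open>\<phi>(S) L_w\<close> at the single vector \<open>L v *v x\<close>.\<close>

lemma inner_fc_L_L_L: "x \<bullet> fc \<phi> (L v *v (L w *v (L v *v x))) = 0"
proof -
  have "x \<bullet> fc \<phi> (L v *v (L w *v (L v *v x))) = - ((L w *v (L v *v x)) \<bullet> fc \<phi> (L v *v x))"
    by (rule inner_fc_L_swap)
  also have "\<dots> = - ((L v *v x) \<bullet> fc \<phi> (L w *v (L v *v x)))"
    by (metis inner_commute inner_fc_left)
  finally show ?thesis by (simp only: inner_fc_L_self minus_zero)
qed

subsection \<open>The geodesics\<close>

text \<open>This is \<open>exp(- t L_v) u\<close>: the even and odd parts of the exponential series,
  summed by means of \<open>L_v^2 = - |v|^2 S^2\<close>.\<close>

definition velocity :: "real^'k \<Rightarrow> real^'m \<Rightarrow> real \<Rightarrow> real^'k" where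
  "velocity u v t =
     fc (\<lambda>a. stumpff 0 (a\<^sup>2 * (v \<bullet> v) * t\<^sup>2)) u - L v *v fc (\<lambda>a. t * stumpff 1 (a\<^sup>2 * (v \<bullet> v) * t\<^sup>2)) u"

definition position :: "real^'k \<Rightarrow> real^'m \<Rightarrow> real \<Rightarrow> real^'k" where
  "position u v t =
     fc (\<lambda>a. t * stumpff 1 (a\<^sup>2 * (v \<bullet> v) * t\<^sup>2)) u
       - L v *v fc (\<lambda>a. t\<^sup>2 * stumpff 2 (a\<^sup>2 * (v \<bullet> v) * t\<^sup>2)) u"

text \<open>The vertical coordinate of the geodesic is this number times \<open>v\<close>; the
  division by 2 comes from the factor \<open>1 / 2\<close> in the frame.\<close>

definition height :: "real^'k \<Rightarrow> real^'m \<Rightarrow> real \<Rightarrow> real" where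
  "height u v t = (u \<bullet> fc (\<lambda>a. a\<^sup>2 * (t ^ 3 * stumpff 3 (a\<^sup>2 * (v \<bullet> v) * t\<^sup>2))) u) / 2"

lemma has_vector_derivative_fc:
  assumes "\<And>a. ((\<lambda>t. \<phi> a t) has_real_derivative \<phi>' a) F"
  shows "((\<lambda>t. fc (\<lambda>a. \<phi> a t) u) has_vector_derivative fc \<phi>' u) F"
proof -
  have "((\<lambda>t. \<chi> i. \<phi> (s i) t * u $ i) has_derivative (\<lambda>h. \<chi> i. \<phi>' (s i) * h * u $ i)) F"
    by (rule has_derivative_vec_lambda)
      (auto intro!: derivative_eq_intros assms[THEN has_field_derivative_imp_has_derivative])
  then show ?thesis
    unfolding has_vector_derivative_def fc_def
    by (rule has_derivative_eq_rhs) (auto simp: vec_eq_iff)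
qed

lemma velocity_has_vector_derivative:
  "(velocity u v has_vector_derivative - (L v *v velocity u v t)) (at t within T)"
proof -
  have 1: "((\<lambda>t. t * stumpff 1 (c * t\<^sup>2)) has_real_derivative stumpff 0 (c * t\<^sup>2)) (at t within T)"
    for c using has_real_derivative_power_stumpff[of 0 c t] by (simp add: has_field_derivative_at_within)
  have 0: "((\<lambda>t. stumpff 0 (c * t\<^sup>2)) has_real_derivative - c * t * stumpff 1 (c * t\<^sup>2)) (at t within T)"
    for c using has_real_derivative_stumpff_0[of c t] by (simp add: has_field_derivative_at_within)
  have "(velocity u v has_vector_derivative
      fc (\<lambda>a. - (a\<^sup>2 * (v \<bullet> v)) * t * stumpff 1 (a\<^sup>2 * (v \<bullet> v) * t\<^sup>2)) u
        - L v *v fc (\<lambda>a. stumpff 0 (a\<^sup>2 * (v \<bullet> v) * t\<^sup>2)) u) (at t within T)"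
    unfolding velocity_def[abs_def]
    by (intro has_vector_derivative_diff has_vector_derivative_fc 0 1
        bounded_linear.has_vector_derivative[OF matrix_vector_mul_bounded_linear])
  also have "fc (\<lambda>a. - (a\<^sup>2 * (v \<bullet> v)) * t * stumpff 1 (a\<^sup>2 * (v \<bullet> v) * t\<^sup>2)) u
        - L v *v fc (\<lambda>a. stumpff 0 (a\<^sup>2 * (v \<bullet> v) * t\<^sup>2)) u = - (L v *v velocity u v t)"
    unfolding velocity_def
    by (simp add: L_linear_simps L_squared L_fc fc_fc fc_linear_simps)
       (simp add: vec_eq_iff fc_nth mult_ac)
  finally show ?thesis .
qed

lemma position_has_vector_derivative:
  "(position u v has_vector_derivative velocity u v t) (at t within T)"
proof -
  have 1: "((\<lambda>t. t * stumpff 1 (c * t\<^sup>2)) has_real_derivative stumpff 0 (c * t\<^sup>2)) (at t within T)"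
    for c using has_real_derivative_power_stumpff[of 0 c t] by (simp add: has_field_derivative_at_within)
  have 2: "((\<lambda>t. t\<^sup>2 * stumpff 2 (c * t\<^sup>2)) has_real_derivative t * stumpff 1 (c * t\<^sup>2)) (at t within T)"
    for c using has_real_derivative_power_stumpff[of 1 c t]
    by (simp add: has_field_derivative_at_within flip: numeral_2_eq_2)
  show ?thesis
    unfolding velocity_def position_def[abs_def]
    by (intro has_vector_derivative_diff has_vector_derivative_fc 1 2
        bounded_linear.has_vector_derivative[OF matrix_vector_mul_bounded_linear])
qed

text \<open>In the expansion the terms with one or three factors \<open>L\<close> vanish by
  skewness, those with two are multiples of \<open>v \<bullet> w\<close>, and
  \<open>stumpff_pythagoras\<close> collapses their coefficients. Hence the vertical velocity is
  parallel to \<open>v\<close>.\<close>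

lemma velocity_L_position:
  "velocity u v t \<bullet> (L w *v position u v t) =
     - (v \<bullet> w) * (u \<bullet> fc (\<lambda>a. a\<^sup>2 * (t\<^sup>2 * stumpff 2 (a\<^sup>2 * (v \<bullet> v) * t\<^sup>2))) u)"
proof -
  define c where "c n a = stumpff n (a\<^sup>2 * (v \<bullet> v) * t\<^sup>2)" for n a
  have pyth: "(c 1 a)\<^sup>2 - c 0 a * c 2 a = c 2 a" for a
    unfolding c_def by (rule stumpff_pythagoras) simp
  have "velocity u v t \<bullet> (L w *v position u v t) =
      u \<bullet> fc (\<lambda>a. c 0 a * (t * c 1 a)) (L w *v u)
      - u \<bullet> fc (\<lambda>a. c 0 a * (t\<^sup>2 * c 2 a)) (L w *v (L v *v u))
      + u \<bullet> fc (\<lambda>a. (t * c 1 a) * (t * c 1 a)) (L v *v (L w *v u))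
      - u \<bullet> fc (\<lambda>a. (t * c 1 a) * (t\<^sup>2 * c 2 a)) (L v *v (L w *v (L v *v u)))"
    unfolding velocity_def position_def c_def
    by (simp add: L_linear_simps inner_diff_left inner_diff_right inner_fc_left inner_L_left
        L_fc fc_fc fc_linear_simps)
  also have "\<dots> = - (v \<bullet> w) * (u \<bullet> fc (\<lambda>a. (t * c 1 a) * (t * c 1 a) * a\<^sup>2) u
      - u \<bullet> fc (\<lambda>a. c 0 a * (t\<^sup>2 * c 2 a) * a\<^sup>2) u)"
    by (simp add: inner_fc_L_self inner_fc_L_L inner_fc_L_L_L inner_commute algebra_simps)
  also have "u \<bullet> fc (\<lambda>a. (t * c 1 a) * (t * c 1 a) * a\<^sup>2) u - u \<bullet> fc (\<lambda>a. c 0 a * (t\<^sup>2 * c 2 a) * a\<^sup>2) u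
      = u \<bullet> fc (\<lambda>a. a\<^sup>2 * (t\<^sup>2 * ((c 1 a)\<^sup>2 - c 0 a * c 2 a))) u"
    unfolding fc_inner_self sum_subtractf[symmetric]
    by (rule sum.cong) (simp_all add: algebra_simps power2_eq_square)
  finally show ?thesis unfolding pyth unfolding c_def .
qed

lemma height_has_vector_derivative:
  "(height u v has_vector_derivative
     (u \<bullet> fc (\<lambda>a. a\<^sup>2 * (t\<^sup>2 * stumpff 2 (a\<^sup>2 * (v \<bullet> v) * t\<^sup>2))) u) / 2) (at t within T)"
proof -
  have "((\<lambda>t. t ^ 3 * stumpff 3 (c * t\<^sup>2)) has_real_derivative t\<^sup>2 * stumpff 2 (c * t\<^sup>2)) (at t within T)"
    for c using has_real_derivative_power_stumpff[of 2 c t]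
    by (simp add: has_field_derivative_at_within flip: numeral_3_eq_3 numeral_2_eq_2)
  then have 3: "((\<lambda>t. a\<^sup>2 * (t ^ 3 * stumpff 3 (c * t\<^sup>2))) has_real_derivative
      a\<^sup>2 * (t\<^sup>2 * stumpff 2 (c * t\<^sup>2))) (at t within T)" for a c
    by (rule DERIV_cmult)
  show ?thesis
    unfolding height_def[abs_def]
    by (intro bounded_linear.has_vector_derivative[OF bounded_linear_divide]
        bounded_linear.has_vector_derivative[OF bounded_linear_inner_right]
        has_vector_derivative_fc 3)
qed

lemma curve_initial: "velocity u v 0 = u" "position u v 0 = 0" "height u v 0 = 0"
  by (simp_all add: velocity_def position_def height_def fc_def stumpff_0 vec_eq_iff
      matrix_vector_mult_def inner_vec_def)

end

section \<open>The exponential map\<close>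

text \<open>The gradient is a definite description; two candidates agree because both represent the
  same derivative, tested on their difference.\<close>

lemma gradient_eqI: "GDERIV F x :> D \<Longrightarrow> gradient F x = D"
  unfolding gradient_def
proof (rule the_equality)
  fix D' assume "GDERIV F x :> D" "GDERIV F x :> D'"
  then have "(D' - D) \<bullet> D' = (D' - D) \<bullet> D"
    unfolding gderiv_def by (metis has_derivative_unique)
  then have "(D' - D) \<bullet> (D' - D) = 0" by (simp add: inner_diff_right)
  then show "D' = D" by simp
qed

lemma has_vector_derivative_eq_on_interval:
  fixes f g :: "real \<Rightarrow> 'a::real_normed_vector"
  assumes "\<And>t. t \<in> {0..1} \<Longrightarrow> (f has_vector_derivative f' t) (at t within {0..1})"
    and "\<And>t. t \<in> {0..1} \<Longrightarrow> (g has_vector_derivative f' t) (at t within {0..1})"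
    and "f 0 = g 0" and "t \<in> {0..1}"
  shows "f t = g t"
proof -
  have "((\<lambda>t. f t - g t) has_vector_derivative 0) (at t within {0..1})" if "t \<in> {0..1}" for t
    using has_vector_derivative_diff[OF assms(1,2)[OF that]] by simp
  then obtain c where "\<And>t. t \<in> {0..1} \<Longrightarrow> f t - g t = c"
    using has_vector_derivative_zero_constant[of "{0..1}" "\<lambda>t. f t - g t"] by auto
  from this[of t] this[of 0] assms(3,4) show ?thesis by simp
qed

lemma bounded_linear_flatten: "bounded_linear flatten"
  by (intro linear_conv_bounded_linear[THEN iffD1] linearI)
    (auto simp: flatten_def vec_eq_iff split: sum.split)

lemma bounded_linear_unflatten: "bounded_linear unflatten"
  by (intro linear_conv_bounded_linear[THEN iffD1] linearI)
    (auto simp: unflatten_def vec_eq_iff)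

lemma unflatten_flatten: "unflatten (flatten q) = q"
  by (simp add: unflatten_def flatten_def prod_eq_iff vec_eq_iff)

lemma block_matrix_vector_mult:
  "block_matrix A B C D *v y =
     flatten (A *v fst (unflatten y) + B *v snd (unflatten y), C *v fst (unflatten y) + D *v snd (unflatten y))"
  by (simp add: vec_eq_iff block_matrix_def flatten_def unflatten_def matrix_vector_mult_def
      sum_UNIV_Plus split: sum.split)

lemma jacobian_flatten:
  assumes "(E has_derivative (\<lambda>h. (A *v fst h + B *v snd h, C *v fst h + D *v snd h))) (at q)"
  shows "jacobian (\<lambda>y. flatten (E (unflatten y))) (at (flatten q)) = block_matrix A B C D"
proof -
  have 1: "(unflatten has_derivative unflatten) (at (flatten q))"
    by (intro bounded_linear_imp_has_derivative bounded_linear_unflatten)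
  have "((\<lambda>y. E (unflatten y)) has_derivative (\<lambda>y. (A *v fst (unflatten y) + B *v snd (unflatten y),
      C *v fst (unflatten y) + D *v snd (unflatten y)))) (at (flatten q))"
    by (rule has_derivative_compose[OF 1]) (simp add: unflatten_flatten assms)
  from bounded_linear.has_derivative[OF bounded_linear_flatten this]
  have "((\<lambda>y. flatten (E (unflatten y))) has_derivative (*v) (block_matrix A B C D)) (at (flatten q))"
    by (rule has_derivative_eq_rhs) (simp add: fun_eq_iff block_matrix_vector_mult)
  then have "frechet_derivative (\<lambda>y. flatten (E (unflatten y))) (at (flatten q)) = (*v) (block_matrix A B C D)"
    by (rule frechet_derivative_at[symmetric])
  then show ?thesis by (simp add: jacobian_def matrix_of_matrix_vector_mul)
qed

lemma outer_vector_mult: "outer v a *v x = (a \<bullet> x) *\<^sub>R v"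
  by (simp add: vec_eq_iff outer_def matrix_vector_mult_def inner_vec_def sum_distrib_left mult_ac)

context htype_matrices
begin

lemma bounded_bilinear_L: "bounded_bilinear (\<lambda>v x. L v *v x)"
proof -
  have "linear (\<lambda>v. L v *v x)" for x
    using linear_L by (auto intro!: linearI simp: linear_add linear_scale matrix_vector_mult_add_rdistrib
        scaleR_matrix_vector_assoc)
  then show ?thesis
    by (intro bilinear_conv_bounded_bilinear[THEN iffD1]) (auto simp: bilinear_def)
qed

lemmas has_derivative_L = bounded_bilinear.FDERIV[OF bounded_bilinear_L]

lemmas L_add = bounded_bilinear.add_left[OF bounded_bilinear_L]
lemmas L_scale = bounded_bilinear.scaleR_left[OF bounded_bilinear_L]

lemma inner_vec_lambda_linear:
  fixes g :: "real^'m \<Rightarrow> real"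
  assumes "linear g"
  shows "w \<bullet> (\<chi> a. g (axis a 1)) = g w"
proof -
  have "g w = g (\<Sum>a\<in>UNIV. w $ a *\<^sub>R axis a 1)"
    by (simp add: basis_expansion flip: scalar_mult_eq_scaleR)
  also have "\<dots> = (\<Sum>a\<in>UNIV. w $ a * g (axis a 1))"
    using assms by (simp add: linear_sum linear_scale)
  finally show ?thesis by (simp add: inner_vec_def)
qed

text \<open>The Hamiltonian in matrix form: the components of the vector inside the norm are the
  values of the covector on the frame fields.\<close>

definition energy :: "((real^'k) \<times> (real^'m)) \<times> ((real^'k) \<times> (real^'m)) \<Rightarrow> real" where
  "energy = (\<lambda>(q, p). (norm (fst p - (1/2) *\<^sub>R (L (snd p) *v fst q)))\<^sup>2 / 2)"

lemma hamiltonian_field_energy: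
  fixes q p :: "(real^'k) \<times> (real^'m)"
  defines "h \<equiv> fst p - (1/2) *\<^sub>R (L (snd p) *v fst q)"
  shows "hamiltonian_field energy (q, p) =
    ((h, \<chi> a. - (h \<bullet> (L (axis a 1) *v fst q)) / 2), (- (1/2) *\<^sub>R (L (snd p) *v h), 0))"
proof -
  let ?G = "\<lambda>w. - (h \<bullet> (L w *v fst q)) / 2"
  have lin: "linear ?G"
    by (rule linearI) (simp_all add: L_add L_scale inner_add_right field_simps)
  have sq: "((\<lambda>y. (norm (g y))\<^sup>2 / 2) has_derivative (\<lambda>d. g y \<bullet> g' d)) (at y)"
    if "(g has_derivative g') (at y)"
    for g :: "(real^'k) \<times> (real^'m) \<Rightarrow> real^'k" and g' y
    unfolding power2_norm_eq_inner
    by (rule derivative_eq_intros refl that)+ (auto simp: inner_commute)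
  have "((\<lambda>p'. fst p' - (1/2) *\<^sub>R (L (snd p') *v fst q)) has_derivative
      (\<lambda>d. fst d - (1/2) *\<^sub>R (L (snd d) *v fst q))) (at p)"
    by (intro derivative_intros bounded_linear.has_derivative[OF
          bounded_bilinear.bounded_linear_left[OF bounded_bilinear_L]])
  from sq[OF this]
  have "GDERIV (\<lambda>p'. energy (q, p')) p :> (h, \<chi> a. ?G (axis a 1))"
    unfolding gderiv_def energy_def prod.case h_def[symmetric]
    by (rule has_derivative_eq_rhs)
      (simp only: inner_prod_def fst_conv snd_conv inner_vec_lambda_linear[OF lin],
        simp add: inner_diff_right inner_commute)
  then have 1: "gradient (\<lambda>p'. energy (q, p')) p = (h, \<chi> a. ?G (axis a 1))"
    by (rule gradient_eqI)
  have "((\<lambda>q'. fst p - (1/2) *\<^sub>R (L (snd p) *v fst q')) has_derivative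
      (\<lambda>d. 0 - (1/2) *\<^sub>R (L (snd p) *v fst d))) (at q)"
    by (intro derivative_intros bounded_linear.has_derivative[OF matrix_vector_mul_bounded_linear])
  from sq[OF this]
  \<comment> \<open>The adjoint of \<open>- L / 2\<close> is \<open>L / 2\<close> by skewness, which
    fixes the sign of this gradient.\<close>
  have "GDERIV (\<lambda>q'. energy (q', p)) q :> ((1/2) *\<^sub>R (L (snd p) *v h), 0)"
    unfolding gderiv_def energy_def prod.case h_def[symmetric]
    by (rule has_derivative_eq_rhs)
      (simp add: fun_eq_iff inner_prod_def inner_commute[of h] inner_L_left)
  then have 2: "gradient (\<lambda>q'. energy (q', p)) q = ((1/2) *\<^sub>R (L (snd p) *v h), 0)"
    by (rule gradient_eqI)
  show ?thesis
    by (simp add: hamiltonian_field_def 1 2)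
qed

section \<open>Existence and uniqueness of the Hamiltonian curve\<close>

definition hamilton_curve ::
    "(real \<Rightarrow> ((real^'k) \<times> (real^'m)) \<times> ((real^'k) \<times> (real^'m))) \<Rightarrow> bool" where
  "hamilton_curve \<Gamma> \<longleftrightarrow> (\<forall>t\<in>{0..1}.
     (\<Gamma> has_vector_derivative hamiltonian_field energy (\<Gamma> t)) (at t within {0..1}))"

lemma area_form:
  "(\<chi> a. - (velocity u v t \<bullet> (L (axis a 1) *v position u v t)) / 2) =
     ((u \<bullet> fc (\<lambda>a. a\<^sup>2 * (t\<^sup>2 * stumpff 2 (a\<^sup>2 * (v \<bullet> v) * t\<^sup>2))) u) / 2) *\<^sub>R v"
  by (simp add: velocity_L_position vec_eq_iff inner_axis)

text \<open>The \<open>dx\<close> part of the covector is not the velocity \<open>h\<close> itself: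
  \<open>h\<close> is that part minus \<open>L v x / 2\<close>, so this term is added back
  here.\<close>

lemma hamilton_curve_exists:
  "hamilton_curve (\<lambda>t. ((position u v t, height u v t *\<^sub>R v),
     (velocity u v t + (1/2) *\<^sub>R (L v *v position u v t), v)))"
  unfolding hamilton_curve_def
proof
  fix t :: real assume "t \<in> {0..1}"
  let ?W = "at t within {0..1}"
  have height: "((\<lambda>t. height u v t *\<^sub>R v) has_vector_derivative
      (\<chi> a. - (velocity u v t \<bullet> (L (axis a 1) *v position u v t)) / 2)) ?W"
    unfolding area_form
    by (rule bounded_linear.has_vector_derivative[OF bounded_linear_scaleR_left height_has_vector_derivative])
  have "((\<lambda>t. velocity u v t + (1/2) *\<^sub>R (L v *v position u v t)) has_vector_derivative
      - (L v *v velocity u v t) + (1/2) *\<^sub>R (L v *v velocity u v t)) ?W"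
    by (intro has_vector_derivative_add velocity_has_vector_derivative
        bounded_linear.has_vector_derivative[OF bounded_linear_scaleR_right]
        bounded_linear.has_vector_derivative[OF matrix_vector_mul_bounded_linear]
        position_has_vector_derivative)
  then have "((\<lambda>t. velocity u v t + (1/2) *\<^sub>R (L v *v position u v t)) has_vector_derivative
      - (1/2) *\<^sub>R (L v *v velocity u v t)) ?W"
    by (rule has_vector_derivative_eq_rhs) (simp add: vec_eq_iff)
  from height this show "((\<lambda>t. ((position u v t, height u v t *\<^sub>R v),
     (velocity u v t + (1/2) *\<^sub>R (L v *v position u v t), v))) has_vector_derivative
     hamiltonian_field energy ((position u v t, height u v t *\<^sub>R v),
     (velocity u v t + (1/2) *\<^sub>R (L v *v position u v t), v))) ?W"
    unfolding hamiltonian_field_energy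
    by (auto intro!: has_vector_derivative_Pair has_vector_derivative_const
        position_has_vector_derivative simp only: fst_conv snd_conv add_diff_cancel_right')
qed

text \<open>The system is triangular. The vertical covector is constant, then \<open>h\<close>
  solves the linear equation \<open>h' = - L_v h\<close>, and finally \<open>x\<close> and
  \<open>z\<close> are antiderivatives of known functions.\<close>

lemma hamilton_curve_unique:
  assumes \<Gamma>: "hamilton_curve \<Gamma>" and init: "\<Gamma> 0 = ((0, 0), (u, v))"
  shows "fst (\<Gamma> 1) = (position u v 1, height u v 1 *\<^sub>R v)"
proof -
  define x z p w where "x = (\<lambda>t. fst (fst (\<Gamma> t)))" and "z = (\<lambda>t. snd (fst (\<Gamma> t)))"
    and "p = (\<lambda>t. fst (snd (\<Gamma> t)))" and "w = (\<lambda>t. snd (snd (\<Gamma> t)))"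
  define h where "h = (\<lambda>t. p t - (1/2) *\<^sub>R (L (w t) *v x t))"
  have D: "(\<Gamma> has_vector_derivative ((h t, \<chi> a. - (h t \<bullet> (L (axis a 1) *v x t)) / 2),
      (- (1/2) *\<^sub>R (L (w t) *v h t), 0))) (at t within {0..1})" if "t \<in> {0..1}" for t
  proof -
    have "\<Gamma> t = ((x t, z t), (p t, w t))" by (simp add: x_def z_def p_def w_def)
    then have "hamiltonian_field energy (\<Gamma> t) =
        ((h t, \<chi> a. - (h t \<bullet> (L (axis a 1) *v x t)) / 2), (- (1/2) *\<^sub>R (L (w t) *v h t), 0))"
      by (simp only: hamiltonian_field_energy h_def fst_conv snd_conv)
    moreover have "(\<Gamma> has_vector_derivative hamiltonian_field energy (\<Gamma> t)) (at t within {0..1})"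
      using \<Gamma> that unfolding hamilton_curve_def by blast
    ultimately show ?thesis by (simp only:)
  qed
  note fstD = bounded_linear.has_vector_derivative[OF bounded_linear_fst]
    and sndD = bounded_linear.has_vector_derivative[OF bounded_linear_snd]
  have x': "(x has_vector_derivative h t) (at t within {0..1})"
    and z': "(z has_vector_derivative (\<chi> a. - (h t \<bullet> (L (axis a 1) *v x t)) / 2)) (at t within {0..1})"
    and p': "(p has_vector_derivative - (1/2) *\<^sub>R (L (w t) *v h t)) (at t within {0..1})"
    and w': "(w has_vector_derivative 0) (at t within {0..1})" if "t \<in> {0..1}" for t
    using fstD[OF fstD[OF D[OF that]]] sndD[OF fstD[OF D[OF that]]]
      fstD[OF sndD[OF D[OF that]]] sndD[OF sndD[OF D[OF that]]]
    unfolding x_def z_def p_def w_def by simp_all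
  have w: "w t = v" if "t \<in> {0..1}" for t
    by (rule has_vector_derivative_eq_on_interval[OF w' has_vector_derivative_const _ that])
      (simp_all add: w_def init)
  \<comment> \<open>With the constant \<open>v\<close> in place of \<open>w t\<close>, the matrix is
    fixed and only \<open>x\<close> is differentiated; the derivatives of \<open>p\<close> and of
    \<open>x\<close> each contribute half of \<open>- L_v h\<close>.\<close>
  have hv: "((\<lambda>t. p t - (1/2) *\<^sub>R (L v *v x t)) has_vector_derivative - (L v *v h t)) (at t within {0..1})"
    if "t \<in> {0..1}" for t
  proof -
    have "((\<lambda>t. p t - (1/2) *\<^sub>R (L v *v x t)) has_vector_derivative
        - (1/2) *\<^sub>R (L (w t) *v h t) - (1/2) *\<^sub>R (L v *v h t)) (at t within {0..1})"
      by (intro has_vector_derivative_diff p'[OF that] x'[OF that]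
          bounded_linear.has_vector_derivative[OF bounded_linear_scaleR_right]
          bounded_linear.has_vector_derivative[OF matrix_vector_mul_bounded_linear])
    also have "- (1/2) *\<^sub>R (L (w t) *v h t) - (1/2) *\<^sub>R (L v *v h t) = - (L v *v h t)"
      by (simp add: w[OF that] vec_eq_iff)
    finally show ?thesis .
  qed
  have h': "(h has_vector_derivative - (L v *v h t)) (at t within {0..1})"
    if "t \<in> {0..1}" for t
    by (rule has_vector_derivative_transform[OF that _ hv[OF that]]) (simp add: h_def w)
  have h: "h t = velocity u v t" if t: "t \<in> {0..1}" for t
  proof -
    \<comment> \<open>The difference of two solutions is again a solution, and skewness of
      \<open>L v\<close> makes its squared norm constant, hence zero.\<close>
    let ?\<delta> = "\<lambda>t. h t - velocity u v t"
    have "((\<lambda>t. ?\<delta> t \<bullet> ?\<delta> t) has_vector_derivative 0) (at t within {0..1})" if "t \<in> {0..1}" for t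
    proof -
      have "(?\<delta> has_vector_derivative - (L v *v h t) - - (L v *v velocity u v t)) (at t within {0..1})"
        by (intro has_vector_derivative_diff h'[OF that] velocity_has_vector_derivative)
      also have "- (L v *v h t) - - (L v *v velocity u v t) = - (L v *v ?\<delta> t)"
        by (simp add: matrix_vector_mult_diff_distrib)
      finally have \<delta>: "(?\<delta> has_vector_derivative - (L v *v ?\<delta> t)) (at t within {0..1})" .
      have "((\<lambda>t. ?\<delta> t \<bullet> ?\<delta> t) has_vector_derivative
          ?\<delta> t \<bullet> - (L v *v ?\<delta> t) + - (L v *v ?\<delta> t) \<bullet> ?\<delta> t) (at t within {0..1})"
        by (rule bounded_bilinear.has_vector_derivative[OF bounded_bilinear_inner \<delta> \<delta>])
      then show ?thesis
        by (simp only: inner_minus_right inner_minus_left inner_commute[of "L v *v _"] L_inner_self) simp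
    qed
    then have "?\<delta> t \<bullet> ?\<delta> t = 0"
      by (rule has_vector_derivative_eq_on_interval[OF _ has_vector_derivative_const _ t])
        (simp_all add: h_def w_def p_def x_def init curve_initial)
    then show ?thesis by simp
  qed
  have x: "x t = position u v t" if "t \<in> {0..1}" for t
  proof (rule has_vector_derivative_eq_on_interval[OF x' _ _ that])
    show "(position u v has_vector_derivative h t) (at t within {0..1})" if "t \<in> {0..1}" for t
      using position_has_vector_derivative by (simp add: h[OF that])
  qed (simp_all add: x_def init curve_initial)
  have z: "z t = height u v t *\<^sub>R v" if "t \<in> {0..1}" for t
  proof (rule has_vector_derivative_eq_on_interval[OF z' _ _ that])
    show "((\<lambda>t. height u v t *\<^sub>R v) has_vector_derivative
        (\<chi> a. - (h t \<bullet> (L (axis a 1) *v x t)) / 2)) (at t within {0..1})" if "t \<in> {0..1}" for t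
      unfolding h[OF that] x[OF that] area_form
      by (rule bounded_linear.has_vector_derivative[OF bounded_linear_scaleR_left height_has_vector_derivative])
  qed (simp_all add: z_def init curve_initial)
  from x[of 1] z[of 1] show ?thesis by (simp add: x_def z_def prod_eq_iff)
qed

lemma hamilton_endpoint:
  "(THE q. \<exists>\<Gamma>. \<Gamma> 0 = ((0, 0), (u, v)) \<and>
      (\<forall>t\<in>{0..1}. (\<Gamma> has_vector_derivative hamiltonian_field energy (\<Gamma> t)) (at t within {0..1})) \<and>
      q = fst (\<Gamma> 1)) = (position u v 1, height u v 1 *\<^sub>R v)"
proof (rule the_equality)
  let ?\<Gamma> = "\<lambda>t. ((position u v t, height u v t *\<^sub>R v),
     (velocity u v t + (1/2) *\<^sub>R (L v *v position u v t), v))"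
  show "\<exists>\<Gamma>. \<Gamma> 0 = ((0, 0), (u, v)) \<and>
      (\<forall>t\<in>{0..1}. (\<Gamma> has_vector_derivative hamiltonian_field energy (\<Gamma> t)) (at t within {0..1})) \<and>
      (position u v 1, height u v 1 *\<^sub>R v) = fst (\<Gamma> 1)"
    using hamilton_curve_exists[of u v]
    by (intro exI[of _ ?\<Gamma>]) (simp add: hamilton_curve_def curve_initial)
qed (auto simp: hamilton_curve_unique hamilton_curve_def)

end

section \<open>The Jacobian matrix\<close>

context htype_matrices
begin

definition exponential :: "(real^'k) \<times> (real^'m) \<Rightarrow> (real^'k) \<times> (real^'m)" where
  "exponential p = (position (fst p) (snd p) 1, height (fst p) (snd p) 1 *\<^sub>R snd p)"

definition hor :: "real^'m \<Rightarrow> real^'k \<Rightarrow> real^'k" where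
  "hor v x = fc (\<lambda>a. stumpff 1 (a\<^sup>2 * (v \<bullet> v))) x - L v *v fc (\<lambda>a. stumpff 2 (a\<^sup>2 * (v \<bullet> v))) x"

text \<open>Derivative of \<open>v \<mapsto> hor v u\<close> in direction \<open>w\<close>. The
  terms with \<open>v \<bullet> w\<close> come from the chain rule through \<open>|v|^2\<close>, the
  last one from the explicit factor \<open>L v\<close>.\<close>

definition hor_dv :: "real^'k \<Rightarrow> real^'m \<Rightarrow> real^'m \<Rightarrow> real^'k" where
  "hor_dv u v w =
     (v \<bullet> w) *\<^sub>R (fc (\<lambda>a. stumpff_deriv 1 (a\<^sup>2 * (v \<bullet> v)) * (2 * a\<^sup>2)) u
       - L v *v fc (\<lambda>a. stumpff_deriv 2 (a\<^sup>2 * (v \<bullet> v)) * (2 * a\<^sup>2)) u)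
     - L w *v fc (\<lambda>a. stumpff 2 (a\<^sup>2 * (v \<bullet> v))) u"

text \<open>Gradient in \<open>u\<close> of the height at time 1, which is half a symmetric
  quadratic form in \<open>u\<close>; \<open>hgt_dv\<close> is the gradient in
  \<open>v\<close>.\<close>

definition hgt_du :: "real^'k \<Rightarrow> real^'m \<Rightarrow> real^'k" where
  "hgt_du u v = fc (\<lambda>a. a\<^sup>2 * stumpff 3 (a\<^sup>2 * (v \<bullet> v))) u"

definition hgt_dv :: "real^'k \<Rightarrow> real^'m \<Rightarrow> real^'m" where
  "hgt_dv u v = (u \<bullet> fc (\<lambda>a. a\<^sup>2 * (stumpff_deriv 3 (a\<^sup>2 * (v \<bullet> v)) * a\<^sup>2)) u) *\<^sub>R v"

definition jac :: "real^'k \<Rightarrow> real^'m \<Rightarrow> real^('k + 'm)^('k + 'm)" where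
  "jac u v = block_matrix (matrix (hor v)) (matrix (hor_dv u v))
     (outer v (hgt_du u v)) (height u v 1 *\<^sub>R mat 1 + outer v (hgt_dv u v))"

lemma position_1: "position u v 1 = hor v u"
  by (simp add: position_def hor_def)

lemma height_1: "height u v 1 = (u \<bullet> hgt_du u v) / 2"
  by (simp add: height_def hgt_du_def)

section \<open>Derivative of the exponential map\<close>

lemma has_derivative_fc:
  assumes \<phi>: "\<And>a. ((\<lambda>p. \<phi> a p) has_derivative \<phi>' a) (at p)" and g: "(g has_derivative g') (at p)"
  shows "((\<lambda>p. fc (\<lambda>a. \<phi> a p) (g p)) has_derivative
    (\<lambda>h. fc (\<lambda>a. \<phi> a p) (g' h) + fc (\<lambda>a. \<phi>' a h) (g p))) (at p)"
proof -
  have "((\<lambda>p. \<chi> i. \<phi> (s i) p * g p $ i) has_derivative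
      (\<lambda>h. \<chi> i. \<phi> (s i) p * g' h $ i + \<phi>' (s i) h * g p $ i)) (at p)"
    by (intro has_derivative_vec_lambda has_derivative_mult \<phi>
        bounded_linear.has_derivative[OF bounded_linear_vec_nth g])
  then show ?thesis
    unfolding fc_def by (rule has_derivative_eq_rhs) (auto simp: vec_eq_iff)
qed

lemma linear_hor: "linear (hor v)"
  by (rule linearI) (simp_all add: hor_def fc_linear_simps L_linear_simps algebra_simps)

lemma fc_scale_coeff: "fc (\<lambda>a. f a * (a\<^sup>2 * (2 * c))) u = c *\<^sub>R fc (\<lambda>a. f a * (2 * a\<^sup>2)) u"
  by (simp add: fc_def vec_eq_iff)

lemma linear_hor_dv: "linear (hor_dv u v)"
  by (rule linearI)
    (simp_all add: hor_dv_def inner_add_right scaleR_add_left L_add L_scale scaleR_diff_right)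

lemmas matrix_hor = fun_cong[OF matrix_vector_mul(2)[OF linear_hor]]
lemmas matrix_hor_dv = fun_cong[OF matrix_vector_mul(2)[OF linear_hor_dv]]

lemma exponential_has_derivative:
  "(exponential has_derivative
     (\<lambda>h. (matrix (hor v) *v fst h + matrix (hor_dv u v) *v snd h,
           outer v (hgt_du u v) *v fst h
             + (height u v 1 *\<^sub>R mat 1 + outer v (hgt_dv u v)) *v snd h))) (at (u, v))"
proof -
  have sq: "((\<lambda>p. snd p \<bullet> snd p) has_derivative (\<lambda>h. 2 * (v \<bullet> snd h))) (at (u, v))"
    by (auto intro!: derivative_eq_intros simp: inner_commute)
  have st: "((\<lambda>p. stumpff n (a\<^sup>2 * (snd p \<bullet> snd p))) has_derivative
      (\<lambda>h. stumpff_deriv n (a\<^sup>2 * (v \<bullet> v)) * (a\<^sup>2 * (2 * (v \<bullet> snd h))))) (at (u, v))" for n a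
    by (rule has_derivative_eq_rhs[OF has_derivative_stumpff_comp[OF
          has_derivative_mult_right[OF sq]]]) (simp add: mult_ac)
  have fst: "(fst has_derivative fst) (at (u, v))" and snd: "(snd has_derivative snd) (at (u, v))"
    by (auto intro!: derivative_intros)
  have 1: "((\<lambda>p. hor (snd p) (fst p)) has_derivative
      (\<lambda>h. hor v (fst h) + hor_dv u v (snd h))) (at (u, v))"
    unfolding hor_def
    by (rule has_derivative_eq_rhs[OF has_derivative_diff[OF has_derivative_fc[OF st fst]
            has_derivative_L[OF snd has_derivative_fc[OF st fst]]]])
      (simp only: hor_dv_def hor_def fun_eq_iff fc_scale_coeff L_linear_simps scaleR_diff_right
        fst_conv snd_conv, simp add: algebra_simps)
  have 2: "((\<lambda>p. (fst p \<bullet> hgt_du (fst p) (snd p)) / 2) has_derivative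
      (\<lambda>h. fst h \<bullet> hgt_du u v + hgt_dv u v \<bullet> snd h)) (at (u, v))"
  proof -
    have "((\<lambda>p. fst p \<bullet> hgt_du (fst p) (snd p)) has_derivative
        (\<lambda>h. u \<bullet> (fc (\<lambda>a. a\<^sup>2 * stumpff 3 (a\<^sup>2 * (v \<bullet> v))) (fst h)
          + fc (\<lambda>a. a\<^sup>2 * (stumpff_deriv 3 (a\<^sup>2 * (v \<bullet> v)) * (a\<^sup>2 * (2 * (v \<bullet> snd h))))) u)
          + fst h \<bullet> hgt_du u v)) (at (u, v))"
      unfolding hgt_du_def
      using has_derivative_inner[OF fst has_derivative_fc[OF has_derivative_mult_right[OF st] fst]]
      by simp
    then have "((\<lambda>p. (fst p \<bullet> hgt_du (fst p) (snd p)) / 2) has_derivative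
        (\<lambda>h. (u \<bullet> (fc (\<lambda>a. a\<^sup>2 * stumpff 3 (a\<^sup>2 * (v \<bullet> v))) (fst h)
          + fc (\<lambda>a. a\<^sup>2 * (stumpff_deriv 3 (a\<^sup>2 * (v \<bullet> v)) * (a\<^sup>2 * (2 * (v \<bullet> snd h))))) u)
          + fst h \<bullet> hgt_du u v) / 2)) (at (u, v))"
      by (rule bounded_linear.has_derivative[OF bounded_linear_divide])
    moreover have "(u \<bullet> (fc (\<lambda>a. a\<^sup>2 * stumpff 3 (a\<^sup>2 * (v \<bullet> v))) x
          + fc (\<lambda>a. a\<^sup>2 * (stumpff_deriv 3 (a\<^sup>2 * (v \<bullet> v)) * (a\<^sup>2 * (2 * (v \<bullet> w))))) u)
          + x \<bullet> hgt_du u v) / 2 = x \<bullet> hgt_du u v + hgt_dv u v \<bullet> w" for x w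
    proof -
      have "fc (\<lambda>a. a\<^sup>2 * (stumpff_deriv 3 (a\<^sup>2 * (v \<bullet> v)) * (a\<^sup>2 * (2 * (v \<bullet> w))))) u =
          (2 * (v \<bullet> w)) *\<^sub>R fc (\<lambda>a. a\<^sup>2 * (stumpff_deriv 3 (a\<^sup>2 * (v \<bullet> v)) * a\<^sup>2)) u"
        by (simp add: fc_def vec_eq_iff)
      moreover have "u \<bullet> fc (\<lambda>a. a\<^sup>2 * stumpff 3 (a\<^sup>2 * (v \<bullet> v))) x = x \<bullet> hgt_du u v"
        unfolding hgt_du_def by (simp only: inner_commute[of u] inner_fc_left)
      ultimately show ?thesis by (simp add: inner_add_right hgt_dv_def)
    qed
    ultimately show ?thesis by (simp only:)
  qed
  have "((\<lambda>p. (hor (snd p) (fst p), ((fst p \<bullet> hgt_du (fst p) (snd p)) / 2) *\<^sub>R snd p)) has_derivative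
      (\<lambda>h. (hor v (fst h) + hor_dv u v (snd h),
        ((u \<bullet> hgt_du u v) / 2) *\<^sub>R snd h + (fst h \<bullet> hgt_du u v + hgt_dv u v \<bullet> snd h) *\<^sub>R v))) (at (u, v))"
    using has_derivative_Pair[OF 1 has_derivative_scaleR[OF 2 snd]] by simp
  then show ?thesis
    unfolding exponential_def[abs_def] position_1 height_1
    by (rule has_derivative_eq_rhs)
      (simp add: fun_eq_iff matrix_hor matrix_hor_dv
        outer_vector_mult matrix_vector_mult_add_rdistrib scaleR_add_left inner_commute
        flip: scaleR_matrix_vector_assoc)
qed

lemma exponential_jacobian:
  "jacobian (\<lambda>y. flatten (exponential (unflatten y))) (at (flatten (u, v))) = jac u v"
  unfolding jac_def by (rule jacobian_flatten[OF exponential_has_derivative])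

subsection \<open>Continuity in the vertical variable\<close>

lemma continuous_on_L [continuous_intros]:
  "continuous_on X g \<Longrightarrow> continuous_on X (\<lambda>x. L (g x))"
  using linear_L by (simp add: linear_conv_bounded_linear bounded_linear.continuous_on)

lemma continuous_on_det_jac: "continuous_on UNIV (\<lambda>v. det (jac u v))"
proof (rule continuous_on_det)
  note unfolds = matrix_def hor_def hor_dv_def hgt_du_def hgt_dv_def outer_def height_1 fc_def
    inner_vec_def matrix_vector_mult_def mat_def vec_lambda_beta vector_minus_component
    vector_add_component vector_scaleR_component
  have A: "continuous_on UNIV (\<lambda>v. matrix (hor v) $ i $ j)" for i j
    unfolding unfolds by (intro continuous_intros)
  have B: "continuous_on UNIV (\<lambda>v. matrix (hor_dv u v) $ i $ j)" for i j
    unfolding unfolds by (intro continuous_intros)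
  have C: "continuous_on UNIV (\<lambda>v. outer v (hgt_du u v) $ i $ j)" for i j
    unfolding unfolds by (intro continuous_intros)
  have D: "continuous_on UNIV (\<lambda>v. (height u v 1 *\<^sub>R mat 1 + outer v (hgt_dv u v)) $ i $ j)" for i j
    unfolding unfolds by (intro continuous_intros) simp_all
  fix i j :: "'k + 'm"
  show "continuous_on UNIV (\<lambda>v. jac u v $ i $ j)"
    unfolding jac_def block_matrix_def vec_lambda_beta
    by (cases i; cases j) (simp_all only: sum.case A B C D)
qed

subsection \<open>The determinant\<close>

lemma det_matrix_fc: "det (matrix (fc \<phi>)) = (\<Prod>i\<in>UNIV. \<phi> (s i))"
  by (subst det_diagonal) (auto simp: matrix_def fc_def axis_def)

text \<open>
  With \<open>R = exp (- L v / 4)\<close>, which is orthogonal, the horizontal part of the exponential map is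
  \<open>R R\<close> times a function of \<open>S\<close>; in a plane this is \<open>(1 - exp (- i \<theta>)) / (i \<theta>) =
  exp (- i \<theta> / 2) sin (\<theta> / 2) / (\<theta> / 2)\<close>.
\<close>

lemma det_hor: "det (matrix (hor v)) = (\<Prod>i\<in>UNIV. stumpff 1 ((s i)\<^sup>2 * (v \<bullet> v) / 4))"
proof -
  define c where "c n a = stumpff n (a\<^sup>2 * (v \<bullet> v) / 4)" for n a
  define b where "b n a = stumpff n (a\<^sup>2 * (v \<bullet> v) / 16)" for n a
  \<comment> \<open>\<open>R (- 1/4)\<close> is \<open>exp(- L_v / 4)\<close> and
    \<open>R (1/4)\<close> is its inverse; the free parameter allows one product formula to serve
    all combinations. The 16 in \<open>b\<close> is the square of this 4.\<close>
  define R where "R \<epsilon> x = fc (b 0) x + \<epsilon> *\<^sub>R (L v *v fc (b 1) x)" for \<epsilon> x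
  have lin: "linear (R \<epsilon>)" for \<epsilon>
    by (rule linearI) (simp_all add: R_def fc_linear_simps L_linear_simps algebra_simps)
  have q: "a\<^sup>2 * (v \<bullet> v) / 4 / 4 = a\<^sup>2 * (v \<bullet> v) / 16" for a by simp
  have cb: "c 0 a = (b 0 a)\<^sup>2 - a\<^sup>2 * (v \<bullet> v) / 16 * (b 1 a)\<^sup>2" "c 1 a = b 0 a * b 1 a"
    "(b 0 a)\<^sup>2 + a\<^sup>2 * (v \<bullet> v) / 16 * (b 1 a)\<^sup>2 = 1" for a
    using stumpff_half_angle(1,2)[of "a\<^sup>2 * (v \<bullet> v) / 4"]
      stumpff_pythagoras(1)[of "a\<^sup>2 * (v \<bullet> v) / 16"]
    unfolding b_def c_def q by simp_all
  have RR: "R \<epsilon> (R \<delta> x) = fc (\<lambda>a. (b 0 a)\<^sup>2 - \<epsilon> * \<delta> * (a\<^sup>2 * (v \<bullet> v)) * (b 1 a)\<^sup>2) x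
      + fc (\<lambda>a. (\<epsilon> + \<delta>) * (b 0 a * b 1 a)) (L v *v x)" for \<epsilon> \<delta> x
    unfolding R_def by (simp add: L_linear_simps L_squared L_fc fc_fc fc_linear_simps)
      (simp add: vec_eq_iff fc_nth algebra_simps power2_eq_square)
  have "R (1/4) (R (- 1/4) x) = fc (\<lambda>a. (b 0 a)\<^sup>2 + a\<^sup>2 * (v \<bullet> v) / 16 * (b 1 a)\<^sup>2) x" for x
    unfolding RR by (simp add: fc_def vec_eq_iff algebra_simps)
  then have "R (1/4) (R (- 1/4) x) = x" for x
    unfolding cb by (simp add: fc_def)
  then have "matrix (R (1/4)) ** matrix (R (- 1/4)) = mat 1"
    by (subst matrix_compose[symmetric, OF lin lin]) (simp add: o_def matrix_def mat_def axis_def vec_eq_iff)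
  moreover have "matrix (R (1/4)) = transpose (matrix (R (- 1/4)))"
  proof -
    have "R (1/4) (axis j 1) $ i = R (- 1/4) (axis i 1) $ j" for i j
    proof -
      have "axis i 1 \<bullet> R (1/4) (axis j 1) = R (- 1/4) (axis i 1) \<bullet> axis j 1"
        unfolding R_def by (simp add: inner_simps inner_fc_left inner_L_left L_fc)
      then show ?thesis by (simp add: inner_axis inner_axis')
    qed
    then show ?thesis by (simp add: vec_eq_iff transpose_def matrix_def)
  qed
  \<comment> \<open>Splitting the half-angle rotation into two equal factors makes its determinant a
    square, so the sign of \<open>det R\<close> is immaterial.\<close>
  ultimately have "det (matrix (R (- 1/4))) * det (matrix (R (- 1/4))) = 1"
    by (metis det_I det_mul det_transpose)
  moreover have "hor v = R (- 1/4) \<circ> R (- 1/4) \<circ> fc (c 1)"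
  proof
    fix x
    have h: "stumpff 1 (a\<^sup>2 * (v \<bullet> v)) = c 0 a * c 1 a" "stumpff 2 (a\<^sup>2 * (v \<bullet> v)) = (c 1 a)\<^sup>2 / 2" for a
      using stumpff_half_angle[of "a\<^sup>2 * (v \<bullet> v)"] by (simp_all add: c_def)
    have "hor v x = fc (\<lambda>a. c 0 a * c 1 a) x - fc (\<lambda>a. (c 1 a)\<^sup>2 / 2) (L v *v x)"
      unfolding hor_def h by (simp only: L_fc)
    also have "\<dots> = R (- 1/4) (R (- 1/4) (fc (c 1) x))"
      unfolding RR fc_fc L_fc
      by (simp add: fc_nth vec_eq_iff cb(1) cb(2)[unfolded One_nat_def] power2_eq_square
          algebra_simps)
    finally show "hor v x = (R (- 1/4) \<circ> R (- 1/4) \<circ> fc (c 1)) x" by simp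
  qed
  ultimately show ?thesis
    by (simp add: matrix_compose lin linear_fc linear_compose det_mul det_matrix_fc c_def)
qed

text \<open>
  The radial derivative of the horizontal part is the horizontal part of
  \<open>\<kappa> u - L v u / 2\<close>, where \<open>\<kappa> = (\<theta> / 2) cot (\<theta> / 2) - 1\<close>.
\<close>

lemma hor_dv_self:
  assumes nz: "\<And>i. stumpff 1 ((s i)\<^sup>2 * (v \<bullet> v) / 4) \<noteq> 0"
  defines "\<kappa> \<equiv> \<lambda>a. stumpff 0 (a\<^sup>2 * (v \<bullet> v) / 4) / stumpff 1 (a\<^sup>2 * (v \<bullet> v) / 4) - 1"
  shows "hor v (fc \<kappa> u - (1/2) *\<^sub>R (L v *v u)) = hor_dv u v v"
proof -
  define y where "y a = a\<^sup>2 * (v \<bullet> v)" for a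
  define c where "c n a = stumpff n (y a)" for n a
  have y: "0 \<le> y a" for a by (simp add: y_def)
  \<comment> \<open>The ladder identity at levels 1 and 2: the radial direction supplies exactly the
    factor \<open>2 y\<close> that it requires.\<close>
  have d: "stumpff_deriv 1 (y a) * (a\<^sup>2 * (2 * (v \<bullet> v))) = c 0 a - c 1 a"
    "stumpff_deriv 2 (y a) * (a\<^sup>2 * (2 * (v \<bullet> v))) = c 1 a - 2 * c 2 a" for a
    using stumpff_deriv_Suc[of "y a" 0] stumpff_deriv_Suc[of "y a" 1]
    by (simp_all add: y_def c_def algebra_simps flip: numeral_2_eq_2)
  have "hor_dv u v v = fc (\<lambda>a. stumpff_deriv 1 (y a) * (a\<^sup>2 * (2 * (v \<bullet> v)))) u
      - L v *v fc (\<lambda>a. stumpff_deriv 2 (y a) * (a\<^sup>2 * (2 * (v \<bullet> v)))) u - L v *v fc (c 2) u"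
    by (simp only: hor_dv_def fc_scale_coeff L_linear_simps scaleR_diff_right y_def c_def[abs_def])
  also have "\<dots> = fc (\<lambda>a. c 0 a - c 1 a) u - fc (\<lambda>a. c 1 a - c 2 a) (L v *v u)"
    unfolding d by (simp only: L_fc) (simp add: fc_def vec_eq_iff algebra_simps)
  finally have "hor_dv u v v = fc (\<lambda>a. c 0 a - c 1 a) u - fc (\<lambda>a. c 1 a - c 2 a) (L v *v u)" .
  moreover have "hor v (fc \<kappa> u - (1/2) *\<^sub>R (L v *v u)) =
      fc (\<lambda>a. c 1 a * \<kappa> a - y a * c 2 a / 2) u - fc (\<lambda>a. c 2 a * \<kappa> a + c 1 a / 2) (L v *v u)"
    unfolding hor_def y_def[symmetric] c_def[symmetric]
    by (simp add: L_linear_simps L_squared L_fc fc_fc fc_linear_simps)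
      (simp add: vec_eq_iff fc_nth y_def algebra_simps)
  \<comment> \<open>With \<open>C\<close> and \<open>D\<close> for \<open>c_0\<close> and
    \<open>c_1\<close> at \<open>y / 4\<close>, one has \<open>\<kappa> = C / D - 1\<close>, and
    both sides become \<open>C^2 - y D^2 / 4 - C D\<close> in the first identity and
    \<open>C D - D^2 / 2\<close> in the second.\<close>
  moreover have "c 1 (s i) * \<kappa> (s i) - y (s i) * c 2 (s i) / 2 = c 0 (s i) - c 1 (s i)"
    "c 2 (s i) * \<kappa> (s i) + c 1 (s i) / 2 = c 1 (s i) - c 2 (s i)" for i
    using nz[of i] unfolding \<kappa>_def c_def y_def[symmetric] stumpff_half_angle[OF y]
    by (simp_all add: field_simps power2_eq_square)
  ultimately show ?thesis by (simp add: fc_def vec_eq_iff)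
qed

lemma det_jac_regular:
  assumes nz: "\<And>i. stumpff 1 ((s i)\<^sup>2 * (v \<bullet> v) / 4) \<noteq> 0"
  shows "det (jac u v) = (\<Prod>i\<in>UNIV. stumpff 1 ((s i)\<^sup>2 * (v \<bullet> v) / 4)) *
    (height u v 1 ^ (CARD('m) - 1) *
     (\<Sum>i\<in>UNIV. (u $ i)\<^sup>2 * ((s i)\<^sup>2 * (stumpff 2 ((s i)\<^sup>2 * (v \<bullet> v)) / 2 - stumpff 3 ((s i)\<^sup>2 * (v \<bullet> v))
        * stumpff 0 ((s i)\<^sup>2 * (v \<bullet> v) / 4) / stumpff 1 ((s i)\<^sup>2 * (v \<bullet> v) / 4)))))"
proof -
  define \<kappa> where "\<kappa> = (\<lambda>a. stumpff 0 (a\<^sup>2 * (v \<bullet> v) / 4) / stumpff 1 (a\<^sup>2 * (v \<bullet> v) / 4) - 1)"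
  define g where "g = fc \<kappa> u - (1/2) *\<^sub>R (L v *v u)"
  let ?F = "matrix (hor v)" and ?a = "hgt_du u v" and ?b = "hgt_dv u v" and ?z = "height u v 1"
  have detF: "det ?F \<noteq> 0" using nz by (simp add: det_hor)
  then have "invertible ?F" by (simp add: invertible_det_nz)
  then obtain Fi where Fi: "?F ** Fi = mat 1" "Fi ** ?F = mat 1" unfolding invertible_def by blast
  define G where "G = Fi ** matrix (hor_dv u v)"
  have FG: "?F ** G = matrix (hor_dv u v)"
    by (simp add: G_def matrix_mul_assoc Fi)
  have "?F *v g = matrix (hor_dv u v) *v v"
    using hor_dv_self[OF nz, of u]
    by (simp add: matrix_hor matrix_hor_dv g_def \<kappa>_def)
  then have Gv: "G *v v = g"
    unfolding G_def by (metis Fi(2) matrix_vector_mul_assoc matrix_vector_mul_lid)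
  have "det (jac u v) = det ?F * det (?z *\<^sub>R mat 1 + outer v ?b - outer v ?a ** G)"
    unfolding jac_def by (rule det_block_matrix_schur[OF FG])
  also have "?z *\<^sub>R mat 1 + outer v ?b - outer v ?a ** G
      = ?z *\<^sub>R mat 1 + outer v (?b - transpose G *v ?a)"
    unfolding outer_matrix_mult by (simp add: outer_minus_right[symmetric])
  also have "det \<dots> = ?z ^ (CARD('m) - 1) * (?z + (?b - transpose G *v ?a) \<bullet> v)"
    by (rule det_scalar_plus_outer)
  \<comment> \<open>The rank one form brings in \<open>G\<close> only through \<open>G v\<close>,
    which is the vector \<open>g\<close> known from the radial derivative.\<close>
  also have "(transpose G *v ?a) \<bullet> v = ?a \<bullet> g"
    by (simp add: Gv dot_lmul_matrix)
  then have "?z + (?b - transpose G *v ?a) \<bullet> v = ?z + ?b \<bullet> v - ?a \<bullet> g"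
    by (simp add: inner_diff_left)
  \<comment> \<open>The part \<open>L v *v u\<close> of \<open>g\<close> drops out, since
    \<open>\<phi>(S) L_v\<close> is skew.\<close>
  also have "?a \<bullet> g = u \<bullet> fc (\<lambda>a. a\<^sup>2 * stumpff 3 (a\<^sup>2 * (v \<bullet> v)) * \<kappa> a) u"
    unfolding hgt_du_def g_def
    by (simp add: inner_fc_left inner_diff_right fc_linear_simps fc_fc inner_fc_L_self)
  also have "?b \<bullet> v = u \<bullet> fc (\<lambda>a. a\<^sup>2 * (stumpff 2 (a\<^sup>2 * (v \<bullet> v)) - 3 * stumpff 3 (a\<^sup>2 * (v \<bullet> v))) / 2) u"
  proof -
    have "2 * (a\<^sup>2 * (v \<bullet> v)) * stumpff_deriv 3 (a\<^sup>2 * (v \<bullet> v)) =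
        stumpff 2 (a\<^sup>2 * (v \<bullet> v)) - 3 * stumpff 3 (a\<^sup>2 * (v \<bullet> v))" for a
      using stumpff_deriv_Suc[of "a\<^sup>2 * (v \<bullet> v)" 2] by (simp flip: numeral_3_eq_3 numeral_2_eq_2)
    note * = this[symmetric]
    show ?thesis unfolding * hgt_dv_def
      by (simp add: fc_inner_self sum_distrib_left mult_ac)
  qed
  \<comment> \<open>The isolated multiples of \<open>c_3\<close> cancel: \<open>1/2\<close> from the
    height, \<open>- 3/2\<close> from its radial derivative, and \<open>1\<close> from the
    \<open>- 1\<close> in \<open>\<kappa>\<close>.\<close>
  also have "?z + u \<bullet> fc (\<lambda>a. a\<^sup>2 * (stumpff 2 (a\<^sup>2 * (v \<bullet> v)) - 3 * stumpff 3 (a\<^sup>2 * (v \<bullet> v))) / 2) u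
      - u \<bullet> fc (\<lambda>a. a\<^sup>2 * stumpff 3 (a\<^sup>2 * (v \<bullet> v)) * \<kappa> a) u =
     (\<Sum>i\<in>UNIV. (u $ i)\<^sup>2 * ((s i)\<^sup>2 * (stumpff 2 ((s i)\<^sup>2 * (v \<bullet> v)) / 2 - stumpff 3 ((s i)\<^sup>2 * (v \<bullet> v))
        * stumpff 0 ((s i)\<^sup>2 * (v \<bullet> v) / 4) / stumpff 1 ((s i)\<^sup>2 * (v \<bullet> v) / 4))))"
    unfolding height_1 hgt_du_def fc_inner_self sum_divide_distrib sum.distrib[symmetric]
      sum_subtractf[symmetric]
    by (rule sum.cong) (simp_all add: \<kappa>_def algebra_simps add_divide_distrib diff_divide_distrib)
  finally show ?thesis by (simp only: det_hor)
qed

text \<open>At \<open>v = 0\<close> every \<open>c_1\<close> equals 1, so the regular formula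
  applies. Its last factor then coincides with the height:
  \<open>c_2 / 2 - c_3 = 1/4 - 1/6 = 1/12\<close>, and \<open>c_3 / 2 = 1/12\<close>.\<close>

lemma det_jac_0: "det (jac u 0) = ((\<Sum>i\<in>UNIV. (s i * u $ i)\<^sup>2) / 12) ^ CARD('m)"
proof -
  have "det (jac u 0) = height u 0 1 ^ (CARD('m) - 1) * (height u 0 1)"
    by (subst det_jac_regular)
      (simp_all add: stumpff_0 fact_numeral height_1 hgt_du_def fc_inner_self sum_divide_distrib
        mult_ac flip: numeral_2_eq_2)
  also have "\<dots> = height u 0 1 ^ CARD('m)"
    by (metis power_minus_mult zero_less_card_finite)
  also have "height u 0 1 = (\<Sum>i\<in>UNIV. (s i * u $ i)\<^sup>2) / 12"
    by (simp add: height_1 hgt_du_def fc_inner_self stumpff_0 fact_numeral power_mult_distrib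
        sum_divide_distrib)
  finally show ?thesis .
qed

end

section \<open>Normal forms\<close>

lemma sum_blocks:
  fixes T :: "nat \<Rightarrow> 'a::comm_monoid_add"
  shows "(\<Sum>p<m + 2 * d. T p) = (\<Sum>p<m. T p) + (\<Sum>i=1..d. T (m + 2 * (i - 1)) + T (m + 2 * (i - 1) + 1))"
  by (induction d) (simp_all add: add.assoc)

lemma sum_block_pos:
  fixes T :: "nat \<Rightarrow> 'a::comm_monoid_add"
  assumes "2 * d \<le> k"
  shows "(\<Sum>p<k. T p) =
    (\<Sum>p<k - 2 * d. T p) + (\<Sum>i=1..d. T (block_pos k d i) + T (block_pos k d i + 1))"
  using sum_blocks[of T "k - 2 * d" d] assms by (simp add: block_pos_def)

text \<open>The lower bounds matter: \<open>i - 1\<close> is truncated, so \<open>i = 0\<close> and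
  \<open>i = 1\<close> have the same position.\<close>

lemma block_pos_eq_iff:
  assumes "1 \<le> i" "1 \<le> j"
  shows "block_pos k d i = block_pos k d j \<longleftrightarrow> i = j"
  using assms by (auto simp: block_pos_def)

text \<open>All block positions have the parity of \<open>k - 2 * d\<close>.\<close>

lemma block_pos_neq_Suc: "block_pos k d i \<noteq> Suc (block_pos k d j)"
  unfolding block_pos_def by presburger

lemma block_pos_less:
  assumes "2 * d \<le> k" "i \<in> {1..d}"
  shows "Suc (block_pos k d i) < k" "k - 2 * d \<le> block_pos k d i"
  using assms by (auto simp: block_pos_def)

lemma block_pos_cases:
  assumes "2 * d \<le> k" "q < k"
  obtains "q < k - 2 * d" | i where "i \<in> {1..d}" "q = block_pos k d i"
    | i where "i \<in> {1..d}" "q = Suc (block_pos k d i)"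
proof (cases "q < k - 2 * d")
  case False
  define r where "r = q - (k - 2 * d)"
  have q: "q = k - 2 * d + r" and "r < 2 * d" using assms False by (auto simp: r_def)
  then have i: "r div 2 + 1 \<in> {1..d}" by auto
  show ?thesis
  proof (cases "even r")
    case True
    then have "q = block_pos k d (r div 2 + 1)" by (simp add: q block_pos_def)
    then show ?thesis using that(2) i by blast
  next
    case False
    then have "q = Suc (block_pos k d (r div 2 + 1))" by (simp add: q block_pos_def)
    then show ?thesis using that(3) i by blast
  qed
qed (use that in blast)

lemma diag_normal_form_block:
  assumes "i \<in> {1..d}"
  shows "diag_normal_form k d \<beta> (block_pos k d i) (block_pos k d i) = \<beta> i"
    and "diag_normal_form k d \<beta> (Suc (block_pos k d i)) (Suc (block_pos k d i)) = \<beta> i"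
proof -
  have "diag_normal_form k d \<beta> (block_pos k d i) (block_pos k d i) = (\<Sum>j=1..d. if j = i then \<beta> j else 0)"
    "diag_normal_form k d \<beta> (Suc (block_pos k d i)) (Suc (block_pos k d i)) = (\<Sum>j=1..d. if j = i then \<beta> j else 0)"
    unfolding diag_normal_form_def
    by (rule sum.cong; use assms in \<open>auto simp: block_pos_eq_iff block_pos_neq_Suc block_pos_neq_Suc[symmetric]\<close>)+
  then show "diag_normal_form k d \<beta> (block_pos k d i) (block_pos k d i) = \<beta> i"
    and "diag_normal_form k d \<beta> (Suc (block_pos k d i)) (Suc (block_pos k d i)) = \<beta> i"
    using assms by (simp_all)
qed

lemma diag_normal_form_zero_block:
  assumes "p < k - 2 * d"
  shows "diag_normal_form k d \<beta> p p = 0"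
  unfolding diag_normal_form_def using assms by (intro sum.neutral) (auto simp: block_pos_def)

lemma diag_normal_form_off_diagonal: "p \<noteq> q \<Longrightarrow> diag_normal_form k d \<beta> p q = 0"
  by (simp add: diag_normal_form_def)

lemma diag_normal_form_nonneg:
  assumes "\<And>i. i \<in> {1..d} \<Longrightarrow> 0 \<le> \<beta> i"
  shows "0 \<le> diag_normal_form k d \<beta> p p"
  unfolding diag_normal_form_def using assms by (intro sum_nonneg) auto

lemma skew_normal_form_columns:
  assumes "i \<in> {1..d}"
  shows "skew_normal_form k d \<beta> l (block_pos k d i) = (if l = Suc (block_pos k d i) then - \<beta> i else 0)"
    and "skew_normal_form k d \<beta> l (Suc (block_pos k d i)) = (if l = block_pos k d i then \<beta> i else 0)"
proof -
  have "skew_normal_form k d \<beta> l (block_pos k d i) =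
      (\<Sum>j=1..d. if j = i then (if l = Suc (block_pos k d i) then - \<beta> i else 0) else 0)"
    "skew_normal_form k d \<beta> l (Suc (block_pos k d i)) =
      (\<Sum>j=1..d. if j = i then (if l = block_pos k d i then \<beta> i else 0) else 0)"
    unfolding skew_normal_form_def
    by (rule sum.cong; use assms in \<open>auto simp: block_pos_eq_iff block_pos_neq_Suc block_pos_neq_Suc[symmetric]\<close>)+
  then show "skew_normal_form k d \<beta> l (block_pos k d i) = (if l = Suc (block_pos k d i) then - \<beta> i else 0)"
    and "skew_normal_form k d \<beta> l (Suc (block_pos k d i)) = (if l = block_pos k d i then \<beta> i else 0)"
    using assms by simp_all
qed

lemma skew_normal_form_zero_block:
  assumes "q < k - 2 * d"
  shows "skew_normal_form k d \<beta> l q = 0"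
  unfolding skew_normal_form_def using assms by (intro sum.neutral) (auto simp: block_pos_def)

text \<open>Spanning follows from the number of vectors; the residual of the expansion is orthogonal
  to all of them and hence to itself.\<close>

lemma orthonormal_family_expansion:
  fixes w :: "nat \<Rightarrow> real^'k"
  assumes w: "\<And>p q. p < CARD('k) \<Longrightarrow> q < CARD('k) \<Longrightarrow> w p \<bullet> w q = (if p = q then 1 else 0)"
  shows "x = (\<Sum>p<CARD('k). (w p \<bullet> x) *\<^sub>R w p)"
proof -
  let ?k = "CARD('k)"
  have inj: "inj_on w {..<?k}"
    by (rule inj_onI) (metis lessThan_iff w zero_neq_one)
  have "pairwise orthogonal (w ` {..<?k})"
    unfolding pairwise_def orthogonal_def using w by auto
  moreover have "0 \<notin> w ` {..<?k}"
    using w by force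
  ultimately have "independent (w ` {..<?k})"
    by (rule pairwise_orthogonal_independent)
  moreover have "card (w ` {..<?k}) = DIM(real^'k)"
    using inj by (simp add: card_image)
  ultimately have span: "span (w ` {..<?k}) = UNIV"
    using card_ge_dim_independent[of "w ` {..<?k}" UNIV] by auto
  define y where "y = x - (\<Sum>p<?k. (w p \<bullet> x) *\<^sub>R w p)"
  have "w q \<bullet> y = 0" if "q < ?k" for q
  proof -
    have "w q \<bullet> (\<Sum>p<?k. (w p \<bullet> x) *\<^sub>R w p) = (\<Sum>p<?k. if p = q then w q \<bullet> x else 0)"
      unfolding inner_sum_right by (rule sum.cong) (use w that in auto)
    then show ?thesis using that by (simp add: y_def inner_diff_right)
  qed
  then have y: "orthogonal y z" if "z \<in> span (w ` {..<?k})" for z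
    by (intro orthogonal_to_span[OF that]) (auto simp: orthogonal_def inner_commute[of y])
  then have "y = 0" unfolding span by (metis UNIV_I orthogonal_self)
  then show ?thesis by (simp add: y_def)
qed

text \<open>Common consequence of the skew normal form of \<open>L v\<close> and the diagonal one of
  \<open>S\<close>: the \<open>w p\<close> are eigenvectors of \<open>S\<close> in block order. It
  mentions \<open>S\<close> alone, so one basis serves a whole ray.\<close>

definition eigenbasis :: "nat \<Rightarrow> nat \<Rightarrow> (nat \<Rightarrow> real) \<Rightarrow> ('k::finite \<Rightarrow> real) \<Rightarrow> (nat \<Rightarrow> real^'k) \<Rightarrow> bool" where
  "eigenbasis k d \<alpha> s w \<longleftrightarrow> k = CARD('k) \<and> 2 * d \<le> k \<and>
     (\<forall>p<k. \<forall>q<k. w p \<bullet> w q = (if p = q then 1 else 0)) \<and>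
     (\<forall>p<k. \<forall>j. s j * w p $ j = diag_normal_form k d \<alpha> p p * w p $ j)"

text \<open>Both sides are \<open>u . g(S) u\<close>, computed in two orthonormal eigenbases;
  \<open>g 0 = 0\<close> removes the kernel block.\<close>

lemma eigenbasis_sum:
  assumes w: "eigenbasis k d \<alpha> s w" and "g 0 = 0"
  shows "(\<Sum>j\<in>UNIV. g (s j) * (u $ j)\<^sup>2) =
    (\<Sum>i=1..d. (norm (block_component k d w u i))\<^sup>2 * g (\<alpha> i))"
proof -
  let ?\<sigma> = "\<lambda>p. diag_normal_form k d \<alpha> p p"
  have k: "k = CARD('a)" and d: "2 * d \<le> k" using w by (auto simp: eigenbasis_def)
  have expansion: "u = (\<Sum>p<k. (w p \<bullet> u) *\<^sub>R w p)"
    unfolding k by (rule orthonormal_family_expansion) (use w in \<open>auto simp: eigenbasis_def\<close>)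
  \<comment> \<open>Where \<open>w p $ j\<close> is non-zero, the two eigenvalues agree, so the
    eigenvector equation passes from \<open>S\<close> to \<open>g(S)\<close>.\<close>
  have eig: "g (s j) * w p $ j = g (?\<sigma> p) * w p $ j" if "p < k" for p j
  proof (cases "w p $ j = 0")
    case False
    then have "s j = ?\<sigma> p" using w that unfolding eigenbasis_def by auto
    then show ?thesis by simp
  qed simp
  have "g (s j) * (u $ j)\<^sup>2 = (\<Sum>p<k. (w p \<bullet> u) * (g (?\<sigma> p) * (w p $ j * u $ j)))" for j
  proof -
    have "g (s j) * (u $ j)\<^sup>2 = g (s j) * (\<Sum>p<k. (w p \<bullet> u) *\<^sub>R w p) $ j * u $ j"
      using expansion by (simp add: power2_eq_square)
    also have "\<dots> = (\<Sum>p<k. (w p \<bullet> u) * ((g (s j) * w p $ j) * u $ j))"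
      by (simp add: sum_component sum_distrib_left sum_distrib_right mult_ac)
    also have "\<dots> = (\<Sum>p<k. (w p \<bullet> u) * (g (?\<sigma> p) * (w p $ j * u $ j)))"
      by (rule sum.cong) (simp_all add: eig)
    finally show ?thesis .
  qed
  then have "(\<Sum>j\<in>UNIV. g (s j) * (u $ j)\<^sup>2) =
      (\<Sum>j\<in>UNIV. \<Sum>p<k. (w p \<bullet> u) * (g (?\<sigma> p) * (w p $ j * u $ j)))" by simp
  also have "\<dots> = (\<Sum>p<k. \<Sum>j\<in>UNIV. (w p \<bullet> u) * (g (?\<sigma> p) * (w p $ j * u $ j)))"
    by (rule sum.swap)
  also have "\<dots> = (\<Sum>p<k. (u \<bullet> w p)\<^sup>2 * g (?\<sigma> p))"
  proof (rule sum.cong)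
    fix p
    have "(\<Sum>j\<in>UNIV. w p $ j * u $ j) = w p \<bullet> u" by (simp add: inner_vec_def)
    then show "(\<Sum>j\<in>UNIV. (w p \<bullet> u) * (g (?\<sigma> p) * (w p $ j * u $ j))) = (u \<bullet> w p)\<^sup>2 * g (?\<sigma> p)"
      by (simp only: sum_distrib_left[symmetric]) (simp add: inner_commute power2_eq_square)
  qed simp
  also have "\<dots> = (\<Sum>i=1..d. (u \<bullet> w (block_pos k d i))\<^sup>2 * g (\<alpha> i)
      + (u \<bullet> w (Suc (block_pos k d i)))\<^sup>2 * g (\<alpha> i))"
    unfolding sum_block_pos[OF d]
    using assms(2) by (simp add: diag_normal_form_zero_block diag_normal_form_block)
  finally show ?thesis
    by (simp add: block_component_def norm_Pair algebra_simps)
qed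

lemma eigenbasis_diag:
  fixes s :: "'k::finite \<Rightarrow> real"
  assumes w: "normalizing_basis k (\<chi> i j. if i = j then s i else 0) (diag_normal_form k d \<alpha>) w"
    and d: "2 * d \<le> k"
  shows "eigenbasis k d \<alpha> s w"
  unfolding eigenbasis_def
proof (intro conjI d allI impI)
  show k: "k = CARD('k)" using w by (simp add: normalizing_basis_def)
  have on: "w p \<bullet> w q = (if p = q then 1 else 0)" if "p < k" "q < k" for p q
    using w that by (simp add: normalizing_basis_def)
  then show "w p \<bullet> w q = (if p = q then 1 else 0)" if "p < k" "q < k" for p q using that .
  let ?D = "\<chi> i j. if i = j then s i else 0"
  fix p j assume p: "p < k"
  have "?D *v w p = (\<Sum>q<k. (w q \<bullet> (?D *v w p)) *\<^sub>R w q)"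
    unfolding k by (rule orthonormal_family_expansion) (use on in \<open>auto simp: k\<close>)
  also have "\<dots> = (\<Sum>q<k. if q = p then diag_normal_form k d \<alpha> p p *\<^sub>R w p else 0)"
    by (rule sum.cong) (use w p in \<open>auto simp: normalizing_basis_def diag_normal_form_off_diagonal\<close>)
  also have "\<dots> = diag_normal_form k d \<alpha> p p *\<^sub>R w p" using p by simp
  finally have "(?D *v w p) $ j = (diag_normal_form k d \<alpha> p p *\<^sub>R w p) $ j" by simp
  then show "s j * w p $ j = diag_normal_form k d \<alpha> p p * w p $ j"
    by (simp add: matrix_vector_mult_def if_distrib[of "\<lambda>c. c * _"] cong: if_cong)
qed

text \<open>Each block of the skew form squares to a scalar matrix. Comparison with
  \<open>L_v^2 = - |v|^2 S^2\<close> makes \<open>w p\<close> an eigenvector of \<open>S^2\<close>,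
  hence of the non-negative \<open>S\<close>.\<close>

lemma (in htype_matrices) eigenbasis_skew:
  assumes w: "normalizing_basis k (L v) (skew_normal_form k d (\<lambda>i. norm v * \<alpha> i)) w"
    and d: "2 * d \<le> k" and \<alpha>: "\<And>i. i \<in> {1..d} \<Longrightarrow> 0 \<le> \<alpha> i" and "v \<noteq> 0"
  shows "eigenbasis k d \<alpha> s w"
  unfolding eigenbasis_def
proof (intro conjI d allI impI)
  show k: "k = CARD('k)" using w by (simp add: normalizing_basis_def)
  have on: "w p \<bullet> w q = (if p = q then 1 else 0)" if "p < k" "q < k" for p q
    using w that by (simp add: normalizing_basis_def)
  then show "w p \<bullet> w q = (if p = q then 1 else 0)" if "p < k" "q < k" for p q using that .
  let ?N = "skew_normal_form k d (\<lambda>i. norm v * \<alpha> i)" and ?\<sigma> = "\<lambda>p. diag_normal_form k d \<alpha> p p"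
  have Lw: "L v *v w p = (\<Sum>q<k. ?N q p *\<^sub>R w q)" if p: "p < k" for p
  proof -
    have "L v *v w p = (\<Sum>q<k. (w q \<bullet> (L v *v w p)) *\<^sub>R w q)"
      unfolding k by (rule orthonormal_family_expansion) (use on in \<open>auto simp: k\<close>)
    also have "\<dots> = (\<Sum>q<k. ?N q p *\<^sub>R w q)"
      by (rule sum.cong) (use w p in \<open>auto simp: normalizing_basis_def\<close>)
    finally show ?thesis .
  qed
  have blocks: "L v *v w (block_pos k d i) = - (norm v * \<alpha> i) *\<^sub>R w (Suc (block_pos k d i))"
    "L v *v w (Suc (block_pos k d i)) = (norm v * \<alpha> i) *\<^sub>R w (block_pos k d i)" if i: "i \<in> {1..d}" for i
    using block_pos_less[OF d i]
    by (simp_all add: Lw skew_normal_form_columns[OF i] if_distrib[of "\<lambda>c. c *\<^sub>R _"] cong: if_cong)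
  fix p j assume p: "p < k"
  have "L v *v (L v *v w p) = - (norm v * ?\<sigma> p)\<^sup>2 *\<^sub>R w p"
  proof (cases rule: block_pos_cases[OF d p])
    case 1
    then show ?thesis by (simp add: Lw[OF p] skew_normal_form_zero_block diag_normal_form_zero_block)
  next
    case (2 i)
    then show ?thesis
      by (simp add: blocks L_linear_simps linear_neg[OF matrix_vector_mul_linear] diag_normal_form_block power2_eq_square)
  next
    case (3 i)
    then show ?thesis
      by (simp add: blocks L_linear_simps diag_normal_form_block power2_eq_square)
  qed
  then have "(v \<bullet> v) *\<^sub>R fc (\<lambda>a. a\<^sup>2) (w p) = (norm v * ?\<sigma> p)\<^sup>2 *\<^sub>R w p"
    by (simp add: L_squared)
  from arg_cong[OF this, of "\<lambda>x. x $ j"]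
  have "(norm v)\<^sup>2 * ((s j)\<^sup>2 * w p $ j) = (norm v)\<^sup>2 * ((?\<sigma> p)\<^sup>2 * w p $ j)"
    by (simp add: fc_nth power2_norm_eq_inner power_mult_distrib mult_ac)
  then have "(s j)\<^sup>2 * w p $ j = (?\<sigma> p)\<^sup>2 * w p $ j" using \<open>v \<noteq> 0\<close> by simp
  then show "s j * w p $ j = ?\<sigma> p * w p $ j"
    using s_nonneg[of j] diag_normal_form_nonneg[of d \<alpha> k p, OF \<alpha>]
    by (auto simp: power2_eq_iff_nonneg)
qed

section \<open>Multiplicities\<close>

lemma prod_group_by_value:
  fixes h :: "'b \<Rightarrow> 'c::comm_monoid_mult"
  assumes "finite A" "finite U" "g ` A \<subseteq> U"
  shows "(\<Prod>x\<in>A. h (g x)) = (\<Prod>t\<in>U. h t ^ card {x \<in> A. g x = t})"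
proof -
  have "(\<Prod>x\<in>A. h (g x)) = (\<Prod>t\<in>U. \<Prod>x\<in>{x \<in> A. g x = t}. h (g x))"
    using prod.group[OF assms, of "\<lambda>x. h (g x)"] by simp
  also have "\<dots> = (\<Prod>t\<in>U. h t ^ card {x \<in> A. g x = t})"
    by (rule prod.cong) auto
  finally show ?thesis .
qed

definition paired :: "('k::finite \<Rightarrow> real) \<Rightarrow> nat \<Rightarrow> (nat \<Rightarrow> real) \<Rightarrow> bool" where
  "paired s d \<alpha> \<longleftrightarrow> (\<forall>i\<in>{1..d}. 0 < \<alpha> i) \<and>
     (\<forall>t. t \<noteq> 0 \<longrightarrow> card {j. s j = t} = 2 * card {i \<in> {1..d}. \<alpha> i = t})"

text \<open>Group both products by value: each non-zero value occurs twice as often among the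
  \<open>s j\<close> as among the \<open>\<alpha> i\<close>, and \<open>h 0 = 1\<close> absorbs the
  kernel.\<close>

lemma paired_prod:
  fixes h :: "real \<Rightarrow> 'c::comm_monoid_mult"
  assumes p: "paired s d \<alpha>" and h: "h 0 = 1"
  shows "(\<Prod>j\<in>UNIV. h (s j)) = (\<Prod>i=1..d. (h (\<alpha> i))\<^sup>2)"
proof -
  let ?U = "range s \<union> \<alpha> ` {1..d}"
  have "(\<Prod>j\<in>UNIV. h (s j)) = (\<Prod>t\<in>?U. h t ^ card {j \<in> UNIV. s j = t})"
    by (rule prod_group_by_value) auto
  also have "\<dots> = (\<Prod>t\<in>?U. ((h t)\<^sup>2) ^ card {i \<in> {1..d}. \<alpha> i = t})"
  proof (rule prod.cong)
    fix t show "h t ^ card {j \<in> UNIV. s j = t} = ((h t)\<^sup>2) ^ card {i \<in> {1..d}. \<alpha> i = t}"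
      using p h by (cases "t = 0") (simp_all add: paired_def power_mult)
  qed simp
  also have "\<dots> = (\<Prod>i=1..d. (h (\<alpha> i))\<^sup>2)"
    by (rule prod_group_by_value[symmetric]) auto
  finally show ?thesis .
qed

lemma paired_le:
  fixes s :: "'k::finite \<Rightarrow> real"
  assumes "paired s d \<alpha>"
  shows "2 * d \<le> CARD('k)"
proof -
  \<comment> \<open>Weight 2 for non-zero eigenvalues turns the count into an exponent:
    \<open>2^(2d)\<close> is a product of \<open>k\<close> factors, each at most 2.\<close>
  let ?h = "\<lambda>t::real. if t = 0 then 1 else 2 :: nat"
  have "(2::nat) ^ (2 * d) = (\<Prod>i=1..d. (?h (\<alpha> i))\<^sup>2)"
  proof -
    have "\<alpha> i \<noteq> 0" if "i \<in> {1..d}" for i using assms that unfolding paired_def by force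
    then have "(\<Prod>i=1..d. (?h (\<alpha> i))\<^sup>2) = (\<Prod>i=1..d. 4)"
      by (intro prod.cong) simp_all
    then show ?thesis by (simp add: power_mult)
  qed
  also have "\<dots> = (\<Prod>j\<in>UNIV. ?h (s j))"
    by (rule paired_prod[symmetric, OF assms]) simp
  also have "\<dots> \<le> (\<Prod>j\<in>(UNIV::'k set). 2)"
    by (rule prod_mono) simp
  finally have "(2::nat) ^ (2 * d) \<le> 2 ^ CARD('k)" by (simp only: prod_constant)
  then show ?thesis by (rule power_le_imp_le_exp[rotated]) simp
qed

lemma paired_value:
  assumes "paired s d \<alpha>" "s j \<noteq> 0"
  obtains i where "i \<in> {1..d}" "s j = \<alpha> i"
proof -
  have "card {l. s l = s j} = 2 * card {i \<in> {1..d}. \<alpha> i = s j}"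
    by (rule conjunct2[OF assms(1)[unfolded paired_def], rule_format, OF assms(2)])
  moreover have "card {l. s l = s j} \<noteq> 0"
    by (auto simp: card_eq_0_iff)
  ultimately have "0 < card {i \<in> {1..d}. \<alpha> i = s j}" by linarith
  then obtain i where "i \<in> {i \<in> {1..d}. \<alpha> i = s j}"
    unfolding card_gt_0_iff by (elim conjE) (erule ex_in_conv[THEN iffD2, THEN exE])
  then show ?thesis by (intro that[of i]) auto
qed

section \<open>The Jacobian determinant\<close>

lemma countable_sin_zeros:
  fixes c :: real
  assumes "c \<noteq> 0"
  shows "countable {t. sin (c * t) = 0}"
proof (rule countable_subset)
  show "{t. sin (c * t) = 0} \<subseteq> range (\<lambda>n::int. of_int n * pi / c)"
  proof
    fix t assume "t \<in> {t. sin (c * t) = 0}"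
    then obtain n :: int where "c * t = of_int n * pi"
      using sin_zero_iff_int2[of "c * t"] by auto
    then have "t = of_int n * pi / c"
      using assms by (simp only: eq_divide_eq) (simp add: mult.commute)
    then show "t \<in> range (\<lambda>n::int. of_int n * pi / c)" by (rule range_eqI)
  qed
qed simp

lemma stumpff_1_square_eq_divide:
  assumes "x \<noteq> 0"
  shows "stumpff 1 (x\<^sup>2) = sin x / x"
  unfolding stumpff_1_square[symmetric] using assms by simp

lemma stumpff_height_summand:
  assumes "a \<noteq> 0" "r \<noteq> 0"
  shows "a\<^sup>2 * stumpff 3 (a\<^sup>2 * r\<^sup>2) / 2 = (a * r - sin (a * r)) / (2 * r ^ 3 * a)"
proof -
  have "(a * r) ^ 3 * stumpff 3 (a\<^sup>2 * r\<^sup>2) = a * r - sin (a * r)"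
    using stumpff_3_square[of "a * r"] by (simp add: power_mult_distrib)
  moreover have "(a * r) ^ 3 \<noteq> 0" using assms by simp
  ultimately have *: "stumpff 3 (a\<^sup>2 * r\<^sup>2) = (a * r - sin (a * r)) / (a * r) ^ 3"
    by (metis nonzero_mult_div_cancel_left)
  have "a\<^sup>2 * (X / (a * r) ^ 3) / 2 = X / (2 * r ^ 3 * a)" for X
    using assms by (simp add: power2_eq_square power3_eq_cube)
  then show ?thesis unfolding * .
qed

text \<open>With \<open>x = a r / 2\<close>, the core is
  \<open>sin^2 x - (x - sin x cos x) cot x = 1 - x cot x\<close>.\<close>

lemma stumpff_radial_summand:
  assumes a: "a \<noteq> 0" and r: "r \<noteq> 0" and nz: "sin (a * r / 2) \<noteq> 0"
  shows "a\<^sup>2 * (stumpff 2 (a\<^sup>2 * r\<^sup>2) / 2 - stumpff 3 (a\<^sup>2 * r\<^sup>2)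
      * stumpff 0 (a\<^sup>2 * r\<^sup>2 / 4) / stumpff 1 (a\<^sup>2 * r\<^sup>2 / 4)) =
    (sin (a * r / 2) - a * r / 2 * cos (a * r / 2)) / (r\<^sup>2 * sin (a * r / 2))"
proof -
  define x where "x = a * r / 2"
  have x: "x \<noteq> 0" "a * r = 2 * x" using a r by (auto simp: x_def)
  have y: "a\<^sup>2 * r\<^sup>2 = (2 * x)\<^sup>2" "a\<^sup>2 * r\<^sup>2 / 4 = x\<^sup>2"
    by (simp_all add: x_def power_mult_distrib power_divide)
  have 2: "stumpff 2 ((2 * x)\<^sup>2) = 2 * (sin x)\<^sup>2 / (2 * x)\<^sup>2"
    using stumpff_2_square[of "2 * x"] x(1) cos_double_sin[of x] by (simp add: field_simps)
  have 3: "stumpff 3 ((2 * x)\<^sup>2) = (2 * x - 2 * sin x * cos x) / (2 * x) ^ 3"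
    using stumpff_3_square[of "2 * x"] x(1) sin_double[of x] by (simp add: field_simps)
  have s: "sin x \<noteq> 0" using nz by (simp add: x_def)
  have "stumpff 2 ((2 * x)\<^sup>2) / 2 - stumpff 3 ((2 * x)\<^sup>2) * stumpff 0 (x\<^sup>2) / stumpff 1 (x\<^sup>2)
      = (sin x - x * cos x) / ((2 * x)\<^sup>2 * sin x)"
  proof -
    have "cos x * (cos x * sin x) + sin x * (sin x * sin x) = sin x * ((sin x)\<^sup>2 + (cos x)\<^sup>2)"
      by (simp only: power2_eq_square distrib_left mult_ac add_ac)
    then have e: "cos x * (cos x * sin x) + sin x * (sin x * sin x) = sin x" by simp
    have "sin x * sin x - (x - sin x * cos x) * cos x / sin x = (sin x - x * cos x) / sin x"
      using s by (simp add: field_simps) (rule e)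
    moreover have "2 * (sin x)\<^sup>2 / (2 * x)\<^sup>2 / 2 - (2 * x - 2 * sin x * cos x) / (2 * x) ^ 3 * cos x / (sin x / x)
        = (sin x * sin x - (x - sin x * cos x) * cos x / sin x) / (2 * x)\<^sup>2"
      using s x(1) by (simp add: divide_simps power2_eq_square power3_eq_cube)
    ultimately show ?thesis
      unfolding 2 3 stumpff_0_square stumpff_1_square_eq_divide[OF x(1)] by simp
  qed
  moreover have "a\<^sup>2 = (2 * x)\<^sup>2 / r\<^sup>2" using r by (simp add: x_def power_mult_distrib)
  ultimately show ?thesis
    unfolding y x_def[symmetric] using x(1) r by (simp add: x_def[symmetric])
qed

context htype_matrices
begin

lemma det_jac_regular_formula:
  assumes w: "eigenbasis k d \<alpha> s w" and p: "paired s d \<alpha>" and "v \<noteq> 0"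
    and nz: "\<And>i. i \<in> {1..d} \<Longrightarrow> sin (\<alpha> i * norm v / 2) \<noteq> 0"
    and n: "n - k = CARD('m)"
  shows "det (jac u v) = jacobian_formula n k d \<alpha> (block_component k d w u) (norm v)"
proof -
  define r where "r = norm v"
  have r: "r \<noteq> 0" "v \<bullet> v = r\<^sup>2" using \<open>v \<noteq> 0\<close> by (simp_all add: r_def power2_norm_eq_inner)
  have \<alpha>: "\<alpha> i \<noteq> 0" if "i \<in> {1..d}" for i using p that unfolding paired_def by force
  let ?c = "block_component k d w u"
  have q: "a\<^sup>2 * r\<^sup>2 / 4 = (a * r / 2)\<^sup>2" for a by (simp add: power_mult_distrib power_divide)
  have reg: "stumpff 1 ((s j)\<^sup>2 * (v \<bullet> v) / 4) \<noteq> 0" for j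
  proof (cases "s j = 0")
    case False
    then obtain i where i: "i \<in> {1..d}" "s j = \<alpha> i" using paired_value[OF p] by blast
    show ?thesis unfolding r q i using \<alpha>[OF i(1)] r(1) nz[OF i(1)]
      by (subst stumpff_1_square_eq_divide) (simp_all add: r_def)
  qed (simp add: stumpff_0)
  have "(\<Prod>j\<in>UNIV. stumpff 1 ((s j)\<^sup>2 * r\<^sup>2 / 4)) = (\<Prod>i=1..d. (stumpff 1 ((\<alpha> i)\<^sup>2 * r\<^sup>2 / 4))\<^sup>2)"
    by (rule paired_prod[OF p, of "\<lambda>a. stumpff 1 (a\<^sup>2 * r\<^sup>2 / 4)"]) (simp add: stumpff_0)
  \<comment> \<open>Each plane contributes the square of
    \<open>sin(\<alpha>_i r / 2) / (\<alpha>_i r / 2)\<close>; here the powers of 2 and the factor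
    \<open>\<alpha>^2\<close> of the final formula originate.\<close>
  also have "\<dots> = (\<Prod>i=1..d. (sin (\<alpha> i * r / 2))\<^sup>2 * 2\<^sup>2 / ((\<alpha> i)\<^sup>2 * r\<^sup>2))"
  proof (rule prod.cong)
    fix i assume "i \<in> {1..d}"
    then have "stumpff 1 ((\<alpha> i)\<^sup>2 * r\<^sup>2 / 4) = sin (\<alpha> i * r / 2) / (\<alpha> i * r / 2)"
      unfolding q using \<alpha> r(1) by (intro stumpff_1_square_eq_divide) simp
    then show "(stumpff 1 ((\<alpha> i)\<^sup>2 * r\<^sup>2 / 4))\<^sup>2 = (sin (\<alpha> i * r / 2))\<^sup>2 * 2\<^sup>2 / ((\<alpha> i)\<^sup>2 * r\<^sup>2)"
      by (simp add: power_divide power_mult_distrib)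
  qed simp
  also have "\<dots> = (\<Prod>i=1..d. (sin (\<alpha> i * r / 2))\<^sup>2) * 2 ^ (2 * d) / ((\<Prod>i=1..d. \<alpha> i)\<^sup>2 * r ^ (2 * d))"
    by (simp add: prod_dividef prod.distrib prod_power_distrib power_mult)
  finally have F: "(\<Prod>j\<in>UNIV. stumpff 1 ((s j)\<^sup>2 * (v \<bullet> v) / 4)) =
    (\<Prod>i=1..d. (sin (\<alpha> i * r / 2))\<^sup>2) * 2 ^ (2 * d) / ((\<Prod>i=1..d. \<alpha> i)\<^sup>2 * r ^ (2 * d))"
    by (simp add: r)
  have "height u v 1 = (\<Sum>j\<in>UNIV. ((s j)\<^sup>2 * stumpff 3 ((s j)\<^sup>2 * r\<^sup>2) / 2) * (u $ j)\<^sup>2)"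
    by (simp add: height_1 hgt_du_def fc_inner_self r sum_divide_distrib)
  also have "\<dots> = (\<Sum>i=1..d. (norm (?c i))\<^sup>2 * ((\<alpha> i)\<^sup>2 * stumpff 3 ((\<alpha> i)\<^sup>2 * r\<^sup>2) / 2))"
    by (rule eigenbasis_sum[OF w, of "\<lambda>a. a\<^sup>2 * stumpff 3 (a\<^sup>2 * r\<^sup>2) / 2"]) simp
  also have "\<dots> = (\<Sum>i=1..d. (norm (?c i))\<^sup>2 * ((\<alpha> i * r - sin (\<alpha> i * r)) / (2 * r ^ 3 * \<alpha> i)))"
    by (rule sum.cong) (simp_all only: stumpff_height_summand[OF \<alpha> r(1)])
  finally have H: "height u v 1 =
    (\<Sum>i=1..d. (norm (?c i))\<^sup>2 * ((\<alpha> i * r - sin (\<alpha> i * r)) / (2 * r ^ 3 * \<alpha> i)))" .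
  let ?P = "\<Prod>i=1..d. (sin (\<alpha> i * r / 2))\<^sup>2"
  let ?g = "\<lambda>a. a\<^sup>2 * (stumpff 2 (a\<^sup>2 * r\<^sup>2) / 2 - stumpff 3 (a\<^sup>2 * r\<^sup>2)
      * stumpff 0 (a\<^sup>2 * r\<^sup>2 / 4) / stumpff 1 (a\<^sup>2 * r\<^sup>2 / 4))"
  have "(\<Sum>j\<in>UNIV. (u $ j)\<^sup>2 * ?g (s j)) = (\<Sum>j\<in>UNIV. ?g (s j) * (u $ j)\<^sup>2)"
    by (simp only: mult.commute)
  also have "\<dots> = (\<Sum>i=1..d. (norm (?c i))\<^sup>2 * ?g (\<alpha> i))"
    by (rule eigenbasis_sum[OF w, of ?g]) simp
  finally have "?P * (\<Sum>j\<in>UNIV. (u $ j)\<^sup>2 * ?g (s j)) = (\<Sum>i=1..d. ?P * ((norm (?c i))\<^sup>2 * ?g (\<alpha> i)))"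
    by (simp only: sum_distrib_left)
  also have "\<dots> = (\<Sum>i=1..d. ((norm (?c i))\<^sup>2
          * (\<Prod>j\<in>{1..d} - {i}. (sin (\<alpha> j * r / 2))\<^sup>2)
          * sin (\<alpha> i * r / 2)
          * (sin (\<alpha> i * r / 2) - \<alpha> i * r / 2 * cos (\<alpha> i * r / 2))) / r\<^sup>2)"
  proof (rule sum.cong)
    fix i assume i: "i \<in> {1..d}"
    have sn: "sin (\<alpha> i * r / 2) \<noteq> 0" using nz[OF i] by (simp add: r_def)
    have P: "?P = (sin (\<alpha> i * r / 2))\<^sup>2 * (\<Prod>j\<in>{1..d} - {i}. (sin (\<alpha> j * r / 2))\<^sup>2)"
      using i by (intro prod.remove) auto
    \<comment> \<open>The radial summand has one sine in its denominator, so of the squared sine of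
      plane \<open>i\<close> a single factor survives.\<close>
    show "?P * ((norm (?c i))\<^sup>2 * ?g (\<alpha> i)) = ((norm (?c i))\<^sup>2
          * (\<Prod>j\<in>{1..d} - {i}. (sin (\<alpha> j * r / 2))\<^sup>2)
          * sin (\<alpha> i * r / 2)
          * (sin (\<alpha> i * r / 2) - \<alpha> i * r / 2 * cos (\<alpha> i * r / 2))) / r\<^sup>2"
      unfolding stumpff_radial_summand[OF \<alpha>[OF i] r(1) sn] P
      using sn r(1) by (simp only: power2_eq_square) (simp add: divide_simps)
  qed simp
  finally have R: "?P * (\<Sum>j\<in>UNIV. (u $ j)\<^sup>2 * ?g (s j)) = (\<Sum>i=1..d. (norm (?c i))\<^sup>2
          * (\<Prod>j\<in>{1..d} - {i}. (sin (\<alpha> j * r / 2))\<^sup>2)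
          * sin (\<alpha> i * r / 2)
          * (sin (\<alpha> i * r / 2) - \<alpha> i * r / 2 * cos (\<alpha> i * r / 2))) / r\<^sup>2"
    by (simp only: sum_divide_distrib)
  have "det (jac u v) = 2 ^ (2 * d) / ((\<Prod>i=1..d. \<alpha> i)\<^sup>2 * r ^ (2 * d)) * height u v 1 ^ (CARD('m) - 1) *
      (?P * (\<Sum>j\<in>UNIV. (u $ j)\<^sup>2 * ?g (s j)))"
    unfolding det_jac_regular[OF reg] F unfolding r(2)
    by (simp only: times_divide_eq_left times_divide_eq_right mult_ac)
  also have "\<dots> = jacobian_formula n k d \<alpha> ?c r"
  proof -
    \<comment> \<open>The exponent \<open>2 * d + 2\<close> is made of \<open>2 * d\<close> from the
      horizontal determinant and 2 from the radial summands.\<close>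
    have "2 ^ (2 * d) / (A * r ^ (2 * d)) * X * (Y / r\<^sup>2) = 2 ^ (2 * d) / (A * r ^ (2 * d + 2)) * X * Y"
      for A X Y by (simp add: power_add mult_ac power2_eq_square)
    then show ?thesis unfolding R H jacobian_formula_def n by (simp only:)
  qed
  finally show ?thesis by (simp add: r_def)
qed

text \<open>
  The exceptional case, where the horizontal part of the exponential map is singular, follows by
  continuity along the ray through \<open>v\<close>.
\<close>

lemma det_jac_formula:
  assumes w: "eigenbasis k d \<alpha> s w" and p: "paired s d \<alpha>" and v: "v \<noteq> 0"
    and n: "n - k = CARD('m)"
  shows "det (jac u v) = jacobian_formula n k d \<alpha> (block_component k d w u) (norm v)"
proof -
  let ?c = "block_component k d w u"
  let ?Z = "\<Union>i\<in>{1..d}. {t. sin ((\<alpha> i * norm v / 2) * t) = 0}"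
  have \<alpha>: "\<alpha> i \<noteq> 0" if "i \<in> {1..d}" for i using p that unfolding paired_def by force
  have "det (jac u (1 *\<^sub>R v)) = jacobian_formula n k d \<alpha> ?c (1 * norm v)"
  \<comment> \<open>The same \<open>w\<close> and components are used at every \<open>t v\<close>,
    so the formula is continuous in \<open>t\<close>; the ray is open at 0, where the formula
    divides by zero.\<close>
  proof (rule continuous_eq_off_countable[where X = "{0<..}" and Z = ?Z
        and f = "\<lambda>t. det (jac u (t *\<^sub>R v))" and g = "\<lambda>t. jacobian_formula n k d \<alpha> ?c (t * norm v)"])
    show "continuous_on {0<..} (\<lambda>t. det (jac u (t *\<^sub>R v)))"
      by (rule continuous_on_compose2[OF continuous_on_det_jac]) (auto intro!: continuous_intros)
    show "continuous_on {0<..} (\<lambda>t. jacobian_formula n k d \<alpha> ?c (t * norm v))"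
      unfolding jacobian_formula_def
      by (intro continuous_intros) (use \<alpha> v in auto)
    show "countable ?Z"
      by (intro countable_UN countable_sin_zeros) (use \<alpha> v in auto)
    show "det (jac u (t *\<^sub>R v)) = jacobian_formula n k d \<alpha> ?c (t * norm v)"
      if "t \<in> {0<..}" "t \<notin> ?Z" for t
      using det_jac_regular_formula[OF w p _ _ n, of "t *\<^sub>R v" u] that v
      by (simp add: mult_ac)
  qed auto
  then show ?thesis by simp
qed

end

section \<open>From the Lie algebra to matrices\<close>

lemma orthonormal_basis_card:
  fixes b :: "'i::finite \<Rightarrow> 'g::euclidean_space"
  assumes on: "\<And>i j. b i \<bullet> b j = (if i = j then 1 else 0)"
  shows "dim (span (b ` A)) = card A" and "inj b"
proof -
  show inj: "inj b"
    by (rule injI) (metis on zero_neq_one)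
  have "pairwise orthogonal (b ` A)"
    unfolding pairwise_def orthogonal_def using on by auto
  moreover have "0 \<notin> b ` A"
  proof
    assume "0 \<in> b ` A"
    then obtain i where "b i = 0" by auto
    then show False using on[of i i] by simp
  qed
  ultimately have "independent (b ` A)"
    by (rule pairwise_orthogonal_independent)
  then show "dim (span (b ` A)) = card A"
    using inj by (simp add: dim_eq_card_independent card_image inj_on_subset)
qed

locale htype_algebra =
  fixes br :: "'g::euclidean_space \<Rightarrow> 'g \<Rightarrow> 'g" and g1 g2 S
    and e :: "'k::finite \<Rightarrow> 'g" and f :: "'m::finite \<Rightarrow> 'g"
  assumes H: "generalized_H_type br g1 g2 S"
    and e: "orthonormal_basis e g1" and f: "orthonormal_basis f g2"
    and diag: "\<exists>c. S (e i) = c *\<^sub>R e i"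
begin

lemma step2: "step2_carnot_algebra br g1 g2" and S_op: "operator_on g1 S"
  and S_nonneg: "X \<in> g1 \<Longrightarrow> 0 \<le> X \<bullet> S X"
  and J_anticommute: "V \<in> g2 \<Longrightarrow> W \<in> g2 \<Longrightarrow> X \<in> g1 \<Longrightarrow>
        J_op br g1 V (J_op br g1 W X) + J_op br g1 W (J_op br g1 V X)
          = (- 2 * (V \<bullet> W)) *\<^sub>R S (S X)"
  using H unfolding generalized_H_type_def by blast+

lemma bilinear: "bilinear br" and g1: "subspace g1" and g2: "subspace g2"
  and decomposition: "{X + V |X V. X \<in> g1 \<and> V \<in> g2} = UNIV" "g1 \<inter> g2 = {0}"
  using step2 unfolding step2_carnot_algebra_def by blast+

lemma e_inner: "e i \<bullet> e j = (if i = j then 1 else 0)"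
  and f_inner: "f a \<bullet> f b = (if a = b then 1 else 0)"
  and span_e: "span (range e) = g1" and span_f: "span (range f) = g2"
  using e f unfolding orthonormal_basis_def by blast+

lemma e_in: "e i \<in> g1" and f_in: "f a \<in> g2"
  using span_base[of "e i" "range e"] span_base[of "f a" "range f"] span_e span_f by auto

lemma dim_g1: "dim g1 = CARD('k)" and dim_g2: "dim g2 = CARD('m)"
  using orthonormal_basis_card(1)[of e UNIV] orthonormal_basis_card(1)[of f UNIV]
  by (simp_all add: e_inner f_inner span_e span_f)

lemma DIM_eq: "DIM('g) = CARD('k) + CARD('m)"
  using dim_sums_Int[OF g1 g2] decomposition by (simp add: dim_g1 dim_g2)

definition eig :: "'k \<Rightarrow> real" where
  "eig i = e i \<bullet> S (e i)"

lemma S_e: "S (e i) = eig i *\<^sub>R e i"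
proof -
  obtain c where c: "S (e i) = c *\<^sub>R e i" using diag by blast
  then have "eig i = c" by (simp add: eig_def e_inner)
  with c show ?thesis by simp
qed

lemma eig_nonneg: "0 \<le> eig i"
  unfolding eig_def by (rule S_nonneg[OF e_in])

definition E :: "real^'k \<Rightarrow> 'g" where
  "E x = (\<Sum>i\<in>UNIV. x $ i *\<^sub>R e i)"

definition V :: "real^'m \<Rightarrow> 'g" where
  "V v = (\<Sum>a\<in>UNIV. v $ a *\<^sub>R f a)"

lemma E_in: "E x \<in> g1" and V_in: "V v \<in> g2"
  unfolding E_def V_def using g1 g2 e_in f_in by (auto intro!: subspace_sum subspace_scale)

lemma e_inner_E: "e i \<bullet> E x = x $ i"
  by (simp add: E_def inner_sum_right e_inner if_distrib[of "\<lambda>c. _ * c"] cong: if_cong)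

lemma E_eqD: "E x = E y \<Longrightarrow> x = y"
  by (simp add: vec_eq_iff flip: e_inner_E)

lemma E_expansion: "X \<in> g1 \<Longrightarrow> X = E (\<chi> i. e i \<bullet> X)"
  using orthonormal_basis_expansion[OF e] by (simp add: E_def)

lemma E_add: "E (x + y) = E x + E y" and E_scale: "E (c *\<^sub>R x) = c *\<^sub>R E x"
  by (simp_all add: E_def scaleR_add_left sum.distrib scaleR_sum_right)

lemma V_inner: "V v \<bullet> V w = v \<bullet> w"
  by (simp add: V_def inner_sum_left inner_sum_right f_inner inner_vec_def
      if_distrib[of "\<lambda>c. _ * c"] mult.commute cong: if_cong)

text \<open>\<open>S\<close> is additive and homogeneous on \<open>g1\<close> only, hence an
  induction over finite sums that stays inside this subspace.\<close>

lemma S_E: "S (E x) = E (\<chi> i. eig i * x $ i)"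
proof -
  have sum: "S (\<Sum>i\<in>A. x $ i *\<^sub>R e i) = (\<Sum>i\<in>A. (eig i * x $ i) *\<^sub>R e i)" if "finite A" for A
    using that
  proof induction
    case empty
    have "S (0 *\<^sub>R 0) = 0 *\<^sub>R S 0"
      using S_op subspace_0[OF g1] unfolding operator_on_def by blast
    then show ?case by simp
  next
    case (insert i A)
    have in1: "x $ i *\<^sub>R e i \<in> g1" "(\<Sum>i\<in>A. x $ i *\<^sub>R e i) \<in> g1"
      using g1 e_in by (auto intro!: subspace_sum subspace_scale)
    have "S (x $ i *\<^sub>R e i + (\<Sum>i\<in>A. x $ i *\<^sub>R e i)) =
        S (x $ i *\<^sub>R e i) + S (\<Sum>i\<in>A. x $ i *\<^sub>R e i)"
      using S_op in1 unfolding operator_on_def by blast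
    moreover have "S (x $ i *\<^sub>R e i) = x $ i *\<^sub>R S (e i)"
      using S_op e_in unfolding operator_on_def by blast
    ultimately show ?case using insert by (simp add: S_e mult.commute)
  qed
  show ?thesis unfolding E_def by (simp add: sum)
qed

abbreviation L :: "real^'m \<Rightarrow> real^'k^'k" where
  "L \<equiv> L_matrix br e f"

lemma L_nth: "L v $ i $ j = V v \<bullet> br (e i) (e j)"
  by (simp add: L_matrix_def struct_matrix_def V_def inner_sum_left sum_component)

lemma bracket_E:
  "V v \<bullet> br (e i) (E x) = (L v *v x) $ i"
  "V v \<bullet> br (E x) Y = (\<Sum>i\<in>UNIV. x $ i * (V v \<bullet> br (e i) Y))"
proof -
  have lin: "linear (br X)" "linear (\<lambda>X. br X Y)" for X Y
    using bilinear by (auto simp: bilinear_def)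
  show "V v \<bullet> br (e i) (E x) = (L v *v x) $ i"
    by (simp add: E_def linear_sum[OF lin(1)] linear_scale[OF lin(1)] inner_sum_right
        matrix_vector_mult_def L_nth mult.commute)
  show "V v \<bullet> br (E x) Y = (\<Sum>i\<in>UNIV. x $ i * (V v \<bullet> br (e i) Y))"
    by (simp add: E_def linear_sum[OF lin(2)] linear_scale[OF lin(2)] inner_sum_right)
qed

text \<open>The entries of \<open>L v\<close> are \<open>g(V, [e_i, e_j])\<close>, so
  \<open>E (L v *v x)\<close> satisfies the defining equation. Any other solution differs from it by
  a vector of \<open>g1\<close> that is orthogonal to itself.\<close>

lemma J_E: "J_op br g1 (V v) (E x) = E (L v *v x)"
  unfolding J_op_def
proof (rule the_equality)
  have "X \<bullet> E (L v *v x) = V v \<bullet> br X (E x)" if "X \<in> g1" for X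
  proof -
    obtain y where y: "X = E y" using E_expansion[OF \<open>X \<in> g1\<close>] by blast
    have "X \<bullet> E (L v *v x) = (\<Sum>i\<in>UNIV. y $ i * (e i \<bullet> E (L v *v x)))"
      by (simp only: y E_def[of y] inner_sum_left inner_scaleR_left)
    also have "\<dots> = V v \<bullet> br X (E x)"
      by (simp only: e_inner_E y bracket_E)
    finally show ?thesis .
  qed
  then show *: "E (L v *v x) \<in> g1 \<and> (\<forall>X\<in>g1. X \<bullet> E (L v *v x) = V v \<bullet> br X (E x))"
    using E_in by blast
  fix Z assume Z: "Z \<in> g1 \<and> (\<forall>X\<in>g1. X \<bullet> Z = V v \<bullet> br X (E x))"
  let ?D = "Z - E (L v *v x)"
  have D: "?D \<in> g1" using Z E_in g1 by (auto intro: subspace_diff)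
  have "?D \<bullet> Z = ?D \<bullet> E (L v *v x)"
    by (rule trans[OF bspec[OF conjunct2[OF Z] D] bspec[OF conjunct2[OF *] D, symmetric]])
  then have "?D \<bullet> ?D = 0" by (simp add: inner_diff_right)
  then show "Z = E (L v *v x)" by simp
qed

sublocale htype_matrices eig L
proof (rule htype_matrices.intro)
  show "0 \<le> eig i" for i by (rule eig_nonneg)
  show "linear L"
    by (rule linearI) (simp_all add: L_matrix_def scaleR_add_left sum.distrib scaleR_sum_right)
  show "L v $ j $ i = - L v $ i $ j" for v i j
    unfolding L_nth by (subst step2_bracket_bracket(4)[OF step2]) simp
  show "L v *v (L w *v x) + L w *v (L v *v x) = (- 2 * (v \<bullet> w)) *\<^sub>R (\<chi> i. (eig i)\<^sup>2 * x $ i)" for v w x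
  proof (rule E_eqD)
    have "E (L v *v (L w *v x) + L w *v (L v *v x)) = (- 2 * (V v \<bullet> V w)) *\<^sub>R S (S (E x))"
      using J_anticommute[OF V_in V_in E_in] by (simp only: E_add J_E)
    also have "\<dots> = E ((- 2 * (v \<bullet> w)) *\<^sub>R (\<chi> i. (eig i)\<^sup>2 * x $ i))"
      by (simp only: S_E V_inner E_scale vec_lambda_beta power2_eq_square mult.assoc)
    finally show "E (L v *v (L w *v x) + L w *v (L v *v x)) =
        E ((- 2 * (v \<bullet> w)) *\<^sub>R (\<chi> i. (eig i)\<^sup>2 * x $ i))" .
  qed
qed

lemma operator_matrix_eq: "operator_matrix e S = (\<chi> i j. if i = j then eig i else 0)"
  by (simp add: operator_matrix_def vec_eq_iff S_e e_inner)

text \<open>In a diagonalizing basis the eigenspace of \<open>t\<close> is spanned by the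
  \<open>e j\<close> with eigenvalue \<open>t\<close>, so dimensions become numbers of
  indices.\<close>

lemma paired_eig:
  assumes "paired_eigenvalues g1 S d \<alpha>"
  shows "paired eig d \<alpha>"
proof -
  have "dim {X \<in> g1. S X = t *\<^sub>R X} = card {j. eig j = t}" for t
  proof -
    have "{X \<in> g1. S X = t *\<^sub>R X} = span (e ` {j. eig j = t})"
    proof (intro equalityI)
      show "{X \<in> g1. S X = t *\<^sub>R X} \<subseteq> span (e ` {j. eig j = t})"
      proof
        fix X assume "X \<in> {X \<in> g1. S X = t *\<^sub>R X}"
        then have X: "X \<in> g1" "S X = t *\<^sub>R X" by auto
        define x where "x = (\<chi> i. e i \<bullet> X)"
        have x: "X = E x" unfolding x_def by (rule E_expansion[OF X(1)])
        have "S (E x) = t *\<^sub>R E x" using X(2) by (simp only: x)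
        then have "(\<chi> i. eig i * x $ i) = t *\<^sub>R x" unfolding S_E E_scale[symmetric] by (rule E_eqD)
        then have eig: "x $ i = 0 \<or> eig i = t" for i by (auto simp: vec_eq_iff)
        have "x $ i *\<^sub>R e i \<in> span (e ` {j. eig j = t})" for i
        proof (cases "x $ i = 0")
          case False
          then have "e i \<in> e ` {j. eig j = t}" using eig[of i] by blast
          then show ?thesis by (intro span_scale span_base)
        qed (simp add: span_zero)
        then show "X \<in> span (e ` {j. eig j = t})" unfolding x E_def by (intro span_sum)
      qed
    next
      have "subspace {X \<in> g1. S X = t *\<^sub>R X}"
      proof (rule subspaceI)
        have "S (0 *\<^sub>R 0) = 0 *\<^sub>R S 0"
          using S_op subspace_0[OF g1] unfolding operator_on_def by blast
        then show "0 \<in> {X \<in> g1. S X = t *\<^sub>R X}" by (simp add: subspace_0[OF g1])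
      next
        fix X Y assume "X \<in> {X \<in> g1. S X = t *\<^sub>R X}" "Y \<in> {X \<in> g1. S X = t *\<^sub>R X}"
        then show "X + Y \<in> {X \<in> g1. S X = t *\<^sub>R X}"
          using S_op unfolding operator_on_def by (simp add: subspace_add[OF g1] scaleR_add_right)
      next
        fix c X assume "X \<in> {X \<in> g1. S X = t *\<^sub>R X}"
        then show "c *\<^sub>R X \<in> {X \<in> g1. S X = t *\<^sub>R X}"
          using S_op unfolding operator_on_def by (simp add: subspace_scale[OF g1])
      qed
      moreover have "e ` {j. eig j = t} \<subseteq> {X \<in> g1. S X = t *\<^sub>R X}"
        by (auto simp: e_in S_e)
      ultimately show "span (e ` {j. eig j = t}) \<subseteq> {X \<in> g1. S X = t *\<^sub>R X}"
        by (rule span_minimal[rotated])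
    qed
    then show ?thesis using orthonormal_basis_card(1)[of e] by (simp add: e_inner)
  qed
  then show ?thesis using assms unfolding paired_eigenvalues_def paired_def by auto
qed

section \<open>The Hamiltonian and the exponential map in coordinates\<close>

lemma frame_inner: "p \<bullet> frame br e f i q = (fst p - (1/2) *\<^sub>R (L (snd p) *v fst q)) $ i"
proof -
  have "(L (snd p) *v fst q) $ i =
      (\<Sum>a\<in>UNIV. snd p $ a * (\<Sum>j\<in>UNIV. struct_matrix br e f a $ i $ j * fst q $ j))"
    unfolding L_matrix_def matrix_vector_mult_def
    by (simp add: sum_component sum_distrib_left sum_distrib_right mult.assoc) (rule sum.swap)
  then show ?thesis
    by (simp add: inner_prod_def frame_def inner_axis)
      (simp add: inner_vec_def sum_negf flip: sum_divide_distrib)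
qed

lemma sr_hamiltonian_eq: "sr_hamiltonian br e f = energy"
  by (simp add: sr_hamiltonian_def energy_def fun_eq_iff frame_inner norm_vec_def L2_set_def
      sum_nonneg)

lemma sr_exp_eq: "sr_exp br e f = exponential"
proof
  fix l :: "(real^'k) \<times> (real^'m)"
  show "sr_exp br e f l = exponential l"
    unfolding sr_exp_def sr_hamiltonian_eq exponential_def
    using hamilton_endpoint[of "fst l" "snd l"] by simp
qed

lemma sr_jacobian_eq: "sr_jacobian br e f u v = det (jac u v)"
  by (simp add: sr_jacobian_def sr_exp_eq exponential_jacobian)

end

theorem lemma20:
  fixes br :: "'g::euclidean_space \<Rightarrow> 'g \<Rightarrow> 'g"
    and g1 g2 :: "'g set"
    and S :: "'g \<Rightarrow> 'g"
    and e :: "'k::finite \<Rightarrow> 'g"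
    and f :: "'m::finite \<Rightarrow> 'g"
    and n k d :: nat
    and \<alpha> :: "nat \<Rightarrow> real"
    and w :: "real^'m \<Rightarrow> nat \<Rightarrow> real^'k"
    and u :: "real^'k"
  assumes "generalized_H_type br g1 g2 S"
    and "n = DIM('g)" and "k = dim g1"
    and "orthonormal_basis e g1" and "orthonormal_basis f g2"
    and "\<forall>i. \<exists>c. S (e i) = c *\<^sub>R e i"
    and "paired_eigenvalues g1 S d \<alpha>"
    and "\<forall>v. v \<noteq> 0 \<longrightarrow>
           normalizing_basis k (L_matrix br e f v) (skew_normal_form k d (\<lambda>i. norm v * \<alpha> i)) (w v)"
    and "normalizing_basis k (operator_matrix e S) (diag_normal_form k d \<alpha>) (w 0)"
  shows "(\<forall>v. sr_exp br e f differentiable at (u, v)) \<and>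
    (\<forall>v. v \<noteq> 0 \<longrightarrow>
       sr_jacobian br e f u v
         = jacobian_formula n k d \<alpha> (block_component k d (w v) u) (norm v)) \<and>
    ((\<lambda>v. jacobian_formula n k d \<alpha> (block_component k d (w v) u) (norm v))
       \<longlongrightarrow> sr_jacobian br e f u 0) (at 0) \<and>
    sr_jacobian br e f u 0
      = (\<Sum>i=1..d. (\<alpha> i * norm (block_component k d (w 0) u i))\<^sup>2 / 12) ^ (n - k) \<and>
    (\<Sum>i=1..d. (\<alpha> i * norm (block_component k d (w 0) u i))\<^sup>2 / 12) ^ (n - k)
      = ((norm (operator_matrix e S *v u))\<^sup>2 / 12) ^ (n - k)"
proof -
  interpret htype_algebra br g1 g2 S e f
    using assms by unfold_locales auto
  have k: "k = CARD('k)" using assms(3) by (simp add: dim_g1)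
  have n: "n - k = CARD('m)" using assms(2) k by (simp add: DIM_eq)
  have p: "paired eig d \<alpha>" by (rule paired_eig[OF assms(7)])
  \<comment> \<open>This ensures that the subtraction \<open>k - 2 * d\<close> in
    \<open>block_pos\<close> is not truncated.\<close>
  have d: "2 * d \<le> k" unfolding k by (rule paired_le[OF p])
  have \<alpha>: "0 \<le> \<alpha> i" if "i \<in> {1..d}" for i
    using p that unfolding paired_def by (simp add: less_imp_le)
  have basis: "eigenbasis k d \<alpha> eig (w v)" if "v \<noteq> 0" for v
    by (rule eigenbasis_skew[OF _ d \<alpha> that]) (use assms(8) that in auto)
  have basis0: "eigenbasis k d \<alpha> eig (w 0)"
    using assms(9) unfolding operator_matrix_eq by (rule eigenbasis_diag) (rule d)
  have J: "sr_jacobian br e f u v = jacobian_formula n k d \<alpha> (block_component k d (w v) u) (norm v)"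
    if "v \<noteq> 0" for v
    unfolding sr_jacobian_eq by (rule det_jac_formula[OF basis[OF that] p that n])
  \<comment> \<open>The components in the formula may jump with \<open>w v\<close>; its limit exists
    because it equals the continuous determinant for all \<open>v \<noteq> 0\<close>.\<close>
  have "((\<lambda>v. det (jac u v)) \<longlongrightarrow> det (jac u 0)) (at 0)"
    using continuous_on_det_jac[of u] by (simp add: continuous_on_def)
  then have lim: "((\<lambda>v. jacobian_formula n k d \<alpha> (block_component k d (w v) u) (norm v))
       \<longlongrightarrow> sr_jacobian br e f u 0) (at 0)"
    unfolding sr_jacobian_eq[symmetric]
    by (rule Lim_transform_eventually) (auto simp: eventually_at_filter J)
  have sum0: "(\<Sum>i=1..d. (\<alpha> i * norm (block_component k d (w 0) u i))\<^sup>2) = (\<Sum>j\<in>UNIV. (eig j * u $ j)\<^sup>2)"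
    using eigenbasis_sum[OF basis0, of "\<lambda>a. a\<^sup>2" u] by (simp add: power_mult_distrib mult.commute)
  have "operator_matrix e S *v u = (\<chi> j. eig j * u $ j)"
    by (simp add: operator_matrix_eq matrix_vector_mult_def vec_eq_iff
        if_distrib[of "\<lambda>c. c * _"] cong: if_cong)
  then have norm: "(norm (operator_matrix e S *v u))\<^sup>2 = (\<Sum>j\<in>UNIV. (eig j * u $ j)\<^sup>2)"
    by (simp add: norm_vec_def L2_set_def sum_nonneg)
  have "sr_exp br e f differentiable at (u, v)" for v
    unfolding sr_exp_eq differentiable_def using exponential_has_derivative by blast
  then show ?thesis
    using J lim unfolding sum_divide_distrib[symmetric] sum0 norm
    by (simp add: sr_jacobian_eq det_jac_0 n)
qed

end
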